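(* Let $(Q,\diamond,e)$ be a pointed Lie rack with the corresponding (tangent) Leibniz algebra $(T_eQ,\{~,~\})$. Let $\mathcal{A}:Q\rightarrow Q$ be a smooth pointed averaging operator on $(Q,\diamond,e)$. (i) Then the differential $\mathcal{A}_{*e}:T_eQ\rightarrow T_eQ$ is a left averaging operator on the Leibniz algebra $(T_eQ,\{~,~\})$. (ii) The Leibniz algebra corresponding to the descendent pointed Lie rack $(Q,\diamond_{\mathcal{A}},e)$, where $x\diamond_{\mathcal{A}}y := \mathcal{A}(x)\diamond y$, is precisely given by $(T_eQ,\{~,~\}_{\mathcal{A}_{*e}})$, where $\{X,Y\}_{\mathcal{A}_{*e}} := \{\mathcal{A}_{*e}(X),Y\}$ for $X,Y\in T_eQ$.
   Context: A (left) rack $(Q,\diamond)$ is a nonempty set $Q$ with a binary operation $\diamond$ such that $x\diamond(y\diamond z) = (x\diamond y)\diamond(x\diamond z)$ for all $x,y,z$, and for any $x,y$ there is a unique $c$ with $x\diamond c = y$. A pointed Lie rack $(Q,\diamond,e)$ is a rack in which $Q$ is a smooth manifold and $\diamond:Q\times Q\to Q$ is smooth, with a distinguished element $e$ such that $x\diamond e=e$ and $e\diamond x=x$ for all $x$. Its tangent Leibniz algebra: for $x\in Q$ let $L_x^\diamond=x\diamond -$ and let $\Theta:Q\to GL(T_eQ)$, $\Theta(x)=T_e(L_x^\diamond)$ (the differential of $L_x^\diamond$ at $e$); let $\mathrm{ad}=T_e\Theta:T_eQ\to gl(T_eQ)$ be the differential of $\Theta$ at $e$; the bracket is $\{X,Y\}:=\mathrm{ad}(X)Y$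 for $X,Y\in T_eQ$. This is a left Leibniz bracket: $\{X,\{Y,Z\}\}=\{\{X,Y\},Z\}+\{Y,\{X,Z\}\}$. A smooth pointed averaging operator on $(Q,\diamond,e)$ is a smooth map $\mathcal{A}:Q\to Q$ with $\mathcal{A}(e)=e$ and $\mathcal{A}(x)\diamond\mathcal{A}(y)=\mathcal{A}(\mathcal{A}(x)\diamond y)$ for all $x,y$; then $(Q,\diamond_{\mathcal{A}},e)$ is a pointed Lie rack. A left averaging operator on a Leibniz algebra $(\mathfrak{h},\{~,~\})$ is a linear map $P:\mathfrak{h}\to\mathfrak{h}$ satisfying $\{P(x),P(y)\}=P\{P(x),y\}$ for all $x,y\in\mathfrak{h}$. *)

theory Defs
  imports "HOL-Analysis.Analysis" "HOL-Library.Function_Algebras"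
begin

subsection \<open>Functions into a real vector space, with pointwise operations\<close>

instantiation "fun" :: (type, real_vector) real_vector
begin

definition scaleR_fun :: "real \<Rightarrow> ('a \<Rightarrow> 'b) \<Rightarrow> 'a \<Rightarrow> 'b" where
  "scaleR_fun r f = (\<lambda>x. r *\<^sub>R f x)"

instance
  by standard (simp_all add: scaleR_fun_def fun_eq_iff scaleR_add_right scaleR_add_left)

end

definition linear_map_on :: "'v::real_vector set \<Rightarrow> 'w::real_vector set \<Rightarrow> ('v \<Rightarrow> 'w) \<Rightarrow> bool" where
  "linear_map_on V W f \<longleftrightarrow>
     f \<in> V \<rightarrow> W \<and>
     (\<forall>x\<in>V. \<forall>y\<in>V. f (x + y) = f x + f y) \<and>
     (\<forall>r. \<forall>x\<in>V. f (r *\<^sub>R x) = r *\<^sub>R f x)"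

text \<open>Maps are normalised to be \<open>0\<close> off \<open>V\<close>, so that \<open>gl V\<close> is a linear subspace of the
  function space that is isomorphic to the space of endomorphisms of \<open>V\<close>.\<close>

definition gl :: "'v::real_vector set \<Rightarrow> ('v \<Rightarrow> 'v) set" where
  "gl V = {f. linear_map_on V V f \<and> (\<forall>x. x \<notin> V \<longrightarrow> f x = 0)}"


subsection \<open>Smooth manifolds and smooth maps\<close>

text \<open>The classes below are meant for open \<open>S\<close> and finite-dimensional domain, where continuity of
  all iterated directional derivatives of the differentiable function \<open>f\<close> up to order \<open>k\<close> is the
  usual \<open>k\<close>-fold continuous differentiability.\<close>

fun Ck_on :: "nat \<Rightarrow> 'e set \<Rightarrow> ('e::real_normed_vector \<Rightarrow> 'f::real_normed_vector) \<Rightarrow> bool" where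
  "Ck_on 0 S f \<longleftrightarrow> continuous_on S f"
| "Ck_on (Suc k) S f \<longleftrightarrow>
     (\<forall>x\<in>S. f differentiable (at x)) \<and>
     (\<forall>v. Ck_on k S (\<lambda>x. frechet_derivative f (at x) v))"

definition smooth_on :: "'e set \<Rightarrow> ('e::real_normed_vector \<Rightarrow> 'f::real_normed_vector) \<Rightarrow> bool" where
  "smooth_on S f \<longleftrightarrow> (\<forall>k. Ck_on k S f)"

text \<open>A chart \<open>(U, \<phi>)\<close> has domain \<open>U\<close>; the values of \<open>\<phi>\<close> outside \<open>U\<close> are irrelevant.\<close>

type_synonym ('a, 'e) chart = "'a set \<times> ('a \<Rightarrow> 'e)"

definition chart_inv :: "('a, 'e) chart \<Rightarrow> 'e \<Rightarrow> 'a" where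
  "chart_inv c = inv_into (fst c) (snd c)"

record ('a, 'e) manifold =
  mtop :: "'a topology"
  atlas :: "('a, 'e) chart set"

abbreviation points :: "('a, 'e) manifold \<Rightarrow> 'a set" where
  "points M \<equiv> topspace (mtop M)"

definition charts_at :: "('a, 'e) manifold \<Rightarrow> 'a \<Rightarrow> ('a, 'e) chart set" where
  "charts_at M p = {c \<in> atlas M. p \<in> fst c}"

text \<open>The model space is an arbitrary finite-dimensional normed space rather than a type of class
  \<open>euclidean_space\<close>, because the latter would exclude manifolds of dimension \<open>0\<close>. The atlas is not
  required to be maximal.\<close>

definition smooth_manifold :: "('a, 'e::real_normed_vector) manifold \<Rightarrow> bool" where
  "smooth_manifold M \<longleftrightarrow>
     (\<exists>B::'e set. finite B \<and> span B = UNIV) \<and>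
     Hausdorff_space (mtop M) \<and> second_countable (mtop M) \<and>
     points M = (\<Union>c\<in>atlas M. fst c) \<and>
     (\<forall>(U, \<phi>)\<in>atlas M.
        openin (mtop M) U \<and> open (\<phi> ` U) \<and>
        homeomorphic_map (subtopology (mtop M) U) (top_of_set (\<phi> ` U)) \<phi>) \<and>
     (\<forall>(U, \<phi>)\<in>atlas M. \<forall>(V, \<psi>)\<in>atlas M.
        smooth_on (\<phi> ` (U \<inter> V)) (\<psi> \<circ> chart_inv (U, \<phi>)))"

definition prod_manifold ::
  "('a, 'e) manifold \<Rightarrow> ('b, 'f) manifold \<Rightarrow> ('a \<times> 'b, 'e \<times> 'f) manifold" where
  "prod_manifold M N =
     \<lparr>mtop = prod_topology (mtop M) (mtop N),
      atlas = {(U \<times> V, map_prod \<phi> \<psi>) |U \<phi> V \<psi>. (U, \<phi>) \<in> atlas M \<and> (V, \<psi>) \<in> atlas N}\<rparr>"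

definition smooth_map ::
  "('a, 'e::real_normed_vector) manifold \<Rightarrow> ('b, 'f::real_normed_vector) manifold
    \<Rightarrow> ('a \<Rightarrow> 'b) \<Rightarrow> bool" where
  "smooth_map M N f \<longleftrightarrow>
     continuous_map (mtop M) (mtop N) f \<and>
     (\<forall>(U, \<phi>)\<in>atlas M. \<forall>(V, \<psi>)\<in>atlas N.
        smooth_on (\<phi> ` (U \<inter> f -` V)) (\<psi> \<circ> f \<circ> chart_inv (U, \<phi>)))"


subsection \<open>Tangent spaces and differentials\<close>

text \<open>A tangent vector at \<open>p\<close> assigns to every chart of the atlas around \<open>p\<close> a coordinate vector,
  such that the coordinate vectors are related by the derivatives of the transition maps.\<close>

type_synonym ('a, 'e) tangent_vector = "('a, 'e) chart \<Rightarrow> 'e"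

definition tangent_space ::
  "('a, 'e::real_normed_vector) manifold \<Rightarrow> 'a \<Rightarrow> ('a, 'e) tangent_vector set" where
  "tangent_space M p =
     {v. (\<forall>c. c \<notin> charts_at M p \<longrightarrow> v c = 0) \<and>
         (\<forall>c\<in>charts_at M p. \<forall>d\<in>charts_at M p.
            v d = frechet_derivative (snd d \<circ> chart_inv c) (at (snd c p)) (v c))}"

definition differential ::
  "('a, 'e::real_normed_vector) manifold \<Rightarrow> ('b, 'f::real_normed_vector) manifold
    \<Rightarrow> ('a \<Rightarrow> 'b) \<Rightarrow> 'a \<Rightarrow> ('a, 'e) tangent_vector \<Rightarrow> ('b, 'f) tangent_vector" where
  "differential M N f p v =
     (THE w. w \<in> tangent_space N (f p) \<and>
        (\<forall>c\<in>charts_at M p. \<forall>d\<in>charts_at N (f p).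
           w d = frechet_derivative (snd d \<circ> f \<circ> chart_inv c) (at (snd c p)) (v c)))"

text \<open>The differential at \<open>p\<close> of a map \<open>F\<close> from \<open>M\<close> to a finite-dimensional real vector space
  \<open>V\<close>, with the tangent spaces of \<open>V\<close> identified with \<open>V\<close>. As \<open>V\<close> is only a subset of a
  \<open>real_vector\<close> type, \<open>F\<close> is differentiated through its linear coordinates \<open>l \<circ> F\<close>;
  linear functionals on \<open>V\<close> are the restrictions of those on the whole type.\<close>

definition vector_differential ::
  "('a, 'e::real_normed_vector) manifold \<Rightarrow> 'v::real_vector set
    \<Rightarrow> ('a \<Rightarrow> 'v) \<Rightarrow> 'a \<Rightarrow> ('a, 'e) tangent_vector \<Rightarrow> 'v" where
  "vector_differential M V F p v =
     (THE w. w \<in> V \<and>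
        (\<forall>l::'v \<Rightarrow> real. linear l \<longrightarrow>
           (\<forall>c\<in>charts_at M p. \<exists>D.
              ((l \<circ> F \<circ> chart_inv c) has_derivative D) (at (snd c p)) \<and> l w = D (v c))))"


subsection \<open>Pointed Lie racks and their tangent Leibniz algebras\<close>

definition rack :: "'a set \<Rightarrow> ('a \<Rightarrow> 'a \<Rightarrow> 'a) \<Rightarrow> bool" where
  "rack Q r \<longleftrightarrow>
     Q \<noteq> {} \<and>
     (\<forall>x\<in>Q. \<forall>y\<in>Q. r x y \<in> Q) \<and>
     (\<forall>x\<in>Q. \<forall>y\<in>Q. \<forall>z\<in>Q. r x (r y z) = r (r x y) (r x z)) \<and>
     (\<forall>x\<in>Q. \<forall>y\<in>Q. \<exists>!c. c \<in> Q \<and> r x c = y)"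

definition pointed_Lie_rack ::
  "('a, 'e::real_normed_vector) manifold \<Rightarrow> ('a \<Rightarrow> 'a \<Rightarrow> 'a) \<Rightarrow> 'a \<Rightarrow> bool" where
  "pointed_Lie_rack Q r e \<longleftrightarrow>
     smooth_manifold Q \<and> rack (points Q) r \<and>
     smooth_map (prod_manifold Q Q) Q (\<lambda>(x, y). r x y) \<and>
     e \<in> points Q \<and> (\<forall>x\<in>points Q. r x e = e \<and> r e x = x)"

definition Theta ::
  "('a, 'e::real_normed_vector) manifold \<Rightarrow> ('a \<Rightarrow> 'a \<Rightarrow> 'a) \<Rightarrow> 'a
    \<Rightarrow> 'a \<Rightarrow> ('a, 'e) tangent_vector \<Rightarrow> ('a, 'e) tangent_vector" where
  "Theta Q r e x =
     (\<lambda>Y. if Y \<in> tangent_space Q e then differential Q Q (r x) e Y else 0)"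

definition ad ::
  "('a, 'e::real_normed_vector) manifold \<Rightarrow> ('a \<Rightarrow> 'a \<Rightarrow> 'a) \<Rightarrow> 'a
    \<Rightarrow> ('a, 'e) tangent_vector \<Rightarrow> ('a, 'e) tangent_vector \<Rightarrow> ('a, 'e) tangent_vector" where
  "ad Q r e = vector_differential Q (gl (tangent_space Q e)) (Theta Q r e) e"

definition tangent_bracket ::
  "('a, 'e::real_normed_vector) manifold \<Rightarrow> ('a \<Rightarrow> 'a \<Rightarrow> 'a) \<Rightarrow> 'a
    \<Rightarrow> ('a, 'e) tangent_vector \<Rightarrow> ('a, 'e) tangent_vector \<Rightarrow> ('a, 'e) tangent_vector" where
  "tangent_bracket Q r e X Y = ad Q r e X Y"

definition leibniz_algebra :: "'v::real_vector set \<Rightarrow> ('v \<Rightarrow> 'v \<Rightarrow> 'v) \<Rightarrow> bool" where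
  "leibniz_algebra V br \<longleftrightarrow>
     subspace V \<and>
     (\<forall>x\<in>V. linear_map_on V V (br x)) \<and>
     (\<forall>y\<in>V. linear_map_on V V (\<lambda>x. br x y)) \<and>
     (\<forall>x\<in>V. \<forall>y\<in>V. \<forall>z\<in>V. br x (br y z) = br (br x y) z + br y (br x z))"


subsection \<open>Averaging operators\<close>

definition smooth_pointed_averaging_operator ::
  "('a, 'e::real_normed_vector) manifold \<Rightarrow> ('a \<Rightarrow> 'a \<Rightarrow> 'a) \<Rightarrow> 'a \<Rightarrow> ('a \<Rightarrow> 'a) \<Rightarrow> bool" where
  "smooth_pointed_averaging_operator Q r e A \<longleftrightarrow>
     smooth_map Q Q A \<and> A e = e \<and>
     (\<forall>x\<in>points Q. \<forall>y\<in>points Q. r (A x) (A y) = A (r (A x) y))"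

definition descendent :: "('a \<Rightarrow> 'a \<Rightarrow> 'a) \<Rightarrow> ('a \<Rightarrow> 'a) \<Rightarrow> 'a \<Rightarrow> 'a \<Rightarrow> 'a" where
  "descendent r A x y = r (A x) y"

definition left_averaging_operator ::
  "'v::real_vector set \<Rightarrow> ('v \<Rightarrow> 'v \<Rightarrow> 'v) \<Rightarrow> ('v \<Rightarrow> 'v) \<Rightarrow> bool" where
  "left_averaging_operator V br P \<longleftrightarrow>
     leibniz_algebra V br \<and> linear_map_on V V P \<and>
     (\<forall>x\<in>V. \<forall>y\<in>V. br (P x) (P y) = P (br (P x) y))"

end

theory Submission
  imports Defs
begin

text \<open>
  In a chart at \<open>e\<close>, let \<open>\<theta> p\<close> be the derivative at \<open>e\<close> of \<open>r p\<close>, and let \<open>\<beta> u v\<close> be the derivative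
  at \<open>e\<close> of \<open>\<lambda>p. \<theta> p v\<close> in the direction \<open>u\<close>; the tangent bracket is \<open>\<beta>\<close> in coordinates. By the chain rule,
  self-distributivity gives \<open>\<theta> p (\<theta> q w) = \<theta> (r p q) (\<theta> p w)\<close>. Differentiating in \<open>q\<close> shows that every
  \<open>\<theta> p\<close> preserves \<open>\<beta>\<close>, and differentiating once more in \<open>p\<close> yields the Leibniz identity. In the same
  way, with \<open>P\<close> the derivative of \<open>A\<close> at \<open>e\<close>, the averaging identity gives
  \<open>\<theta> (A p) (P v) = P (\<theta> (A p) v)\<close>, whose derivative in \<open>p\<close> is \<open>\<beta> (P u) (P v) = P (\<beta> (P u) v)\<close>. The
  descendent rack has \<open>\<theta>' p = \<theta> (A p)\<close>, so \<open>\<beta>' u v = \<beta> (P u) v\<close>.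
\<close>

subsection \<open>Finite-dimensional normed spaces\<close>

text \<open>The finite-dimensionality clause of \<open>smooth_manifold\<close>, as a predicate on
  types. The model space is a bare normed space, so bounds on linear maps are derived from a finite
  spanning set.\<close>

definition fin_dim :: "'e::real_vector itself \<Rightarrow> bool" where
  "fin_dim _ \<longleftrightarrow> (\<exists>B::'e set. finite B \<and> span B = UNIV)"

text \<open>The norm attains a positive minimum on the compact set of linear combinations whose
  coefficients have absolute sum \<open>1\<close>.\<close>

lemma finite_independent_norm_bound:
  fixes B :: "'e::real_normed_vector set"
  assumes B: "finite B" "independent B"
  shows "\<exists>C. \<forall>c. (\<Sum>b\<in>B. \<bar>c b\<bar>) \<le> C * norm (\<Sum>b\<in>B. c b *\<^sub>R b)"
proof (cases "B = {}")
  case False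
  \<comment> \<open>Coefficients are total functions; pinning those outside \<open>B\<close> at 0
    makes \<open>K\<close> a closed subset of a product of compact sets, so Tychonoff's theorem
    applies.\<close>
  define K where "K = Pi\<^sub>E UNIV (\<lambda>b::'e. if b \<in> B then {-1..1::real} else {0})
    \<inter> {c. (\<Sum>b\<in>B. \<bar>c b\<bar>) = 1}"
  have "compact (Pi\<^sub>E UNIV (\<lambda>b::'e. if b \<in> B then {-1..1::real} else {0}))"
    unfolding compactin_euclidean_iff[symmetric] euclidean_product_topology[symmetric]
      compactin_PiE by auto
  moreover have "closed {c::'e \<Rightarrow> real. (\<Sum>b\<in>B. \<bar>c b\<bar>) = 1}"
    by (intro closed_Collect_eq continuous_intros)
      (auto intro: continuous_on_product_coordinates)
  ultimately have K: "compact K"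
    unfolding K_def by (rule compact_Int_closed)
  have sum1: "(\<lambda>b. c b / (\<Sum>b\<in>B. \<bar>c b\<bar>)) \<in> K"
    if "\<forall>b. b \<notin> B \<longrightarrow> c b = 0" "(\<Sum>b\<in>B. \<bar>c b\<bar>) > 0" for c :: "'e \<Rightarrow> real"
  proof -
    have "\<bar>c b\<bar> \<le> (\<Sum>b\<in>B. \<bar>c b\<bar>)" if "b \<in> B" for b
      using that B by (intro member_le_sum) auto
    then have "-1 \<le> c b / (\<Sum>b\<in>B. \<bar>c b\<bar>) \<and> c b / (\<Sum>b\<in>B. \<bar>c b\<bar>) \<le> 1" if "b \<in> B" for b
      using that \<open>(\<Sum>b\<in>B. \<bar>c b\<bar>) > 0\<close>
      by (simp add: pos_le_divide_eq pos_divide_le_eq abs_le_iff minus_le_iff)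
    moreover have "(\<Sum>b\<in>B. \<bar>c b / (\<Sum>b\<in>B. \<bar>c b\<bar>)\<bar>) = 1"
      using that by (simp add: abs_divide sum_divide_distrib[symmetric])
    ultimately show ?thesis
      using that by (simp add: K_def PiE_def Pi_def del: abs_divide)
  qed
  obtain b0 where "b0 \<in> B" using False by auto
  have "(\<Sum>b\<in>B. \<bar>of_bool (b = b0)\<bar> :: real) = (\<Sum>b\<in>B. if b = b0 then 1 else 0)"
    by (intro sum.cong) auto
  also have "\<dots> = 1" using B \<open>b0 \<in> B\<close> by simp
  finally have "K \<noteq> {}"
    using sum1[of "\<lambda>b. of_bool (b = b0)"] \<open>b0 \<in> B\<close> by force
  moreover have "continuous_on K (\<lambda>c. norm (\<Sum>b\<in>B. c b *\<^sub>R b))"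
    by (intro continuous_intros) (auto intro: continuous_on_product_coordinates
        continuous_on_subset[of UNIV])
  ultimately obtain c0 where c0: "c0 \<in> K"
    "\<And>c. c \<in> K \<Longrightarrow> norm (\<Sum>b\<in>B. c0 b *\<^sub>R b) \<le> norm (\<Sum>b\<in>B. c b *\<^sub>R b)"
    using continuous_attains_inf[OF K] by blast
  define m where "m = norm (\<Sum>b\<in>B. c0 b *\<^sub>R b)"
  have "m > 0"
  proof (rule ccontr)
    assume "\<not> m > 0"
    then have "(\<Sum>b\<in>B. c0 b *\<^sub>R b) = 0" by (simp add: m_def)
    then have "\<forall>b\<in>B. c0 b = 0"
      using B independentD by blast
    then show False using c0(1) by (simp add: K_def)
  qed
  have "(\<Sum>b\<in>B. \<bar>c b\<bar>) \<le> (1/m) * norm (\<Sum>b\<in>B. c b *\<^sub>R b)" for c :: "'e \<Rightarrow> real"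
  proof (cases "(\<Sum>b\<in>B. \<bar>c b\<bar>) > 0")
    case True
    define s where "s = (\<Sum>b\<in>B. \<bar>c b\<bar>)"
    define d where "d = (\<lambda>b. if b \<in> B then c b else 0)"
    have s: "(\<Sum>b\<in>B. \<bar>d b\<bar>) = s" by (simp add: d_def s_def)
    have "m \<le> norm (\<Sum>b\<in>B. (d b / s) *\<^sub>R b)"
      using sum1[of d] True unfolding m_def s by (intro c0(2)) (simp add: s_def d_def)
    also have "(\<Sum>b\<in>B. (d b / s) *\<^sub>R b) = (1/s) *\<^sub>R (\<Sum>b\<in>B. c b *\<^sub>R b)"
      unfolding scaleR_sum_right by (intro sum.cong) (auto simp: d_def)
    also have "norm \<dots> = norm (\<Sum>b\<in>B. c b *\<^sub>R b) / s"
      using True by (simp add: s_def)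
    finally show ?thesis
      using True \<open>m > 0\<close> by (simp add: s_def field_simps)
  next
    case False
    then show ?thesis using \<open>m > 0\<close>
      by (smt (verit) divide_nonneg_nonneg mult_nonneg_nonneg norm_ge_zero)
  qed
  then show ?thesis by blast
qed auto

text \<open>A basis is extracted from the spanning set. Its coordinate functionals are bounded
  because the norm dominates the sum of the absolute values of the coordinates; for \<open>b\<close>
  outside the basis the functional is zero.\<close>

lemma fin_dim_coordinates:
  assumes "fin_dim TYPE('e::real_normed_vector)"
  obtains B :: "'e::real_normed_vector set" and k :: "'e \<Rightarrow> 'e \<Rightarrow> real"
  where "finite B" "\<And>b. bounded_linear (k b)" "\<And>v. v = (\<Sum>b\<in>B. k b v *\<^sub>R b)"
proof -
  obtain B0 :: "'e set" where B0: "finite B0" "span B0 = UNIV"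
    using assms unfolding fin_dim_def by blast
  obtain B where B: "B \<subseteq> B0" "independent B" "span B = UNIV"
    using B0 by (metis maximal_independent_subset span_eq span_superset span_mono
        dual_order.antisym top_greatest span_span)
  have fin: "finite B" using B B0 finite_subset by blast
  define k where "k b v = representation B v b" for b v
  have eq: "v = (\<Sum>b\<in>B. k b v *\<^sub>R b)" for v
    using real_vector.sum_representation_eq[of B v B] B fin by (simp add: k_def)
  obtain C where C: "\<And>c. (\<Sum>b\<in>B. \<bar>c b\<bar>) \<le> C * norm (\<Sum>b\<in>B. c b *\<^sub>R b)"
    using finite_independent_norm_bound[OF fin B(2)] by blast
  have "bounded_linear (k b)" for b
  proof
    show "k b (x + y) = k b x + k b y" for x y
      using B by (simp add: k_def real_vector.representation_add)
    show "k b (r *\<^sub>R x) = r *\<^sub>R k b x" for r x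
      using B by (simp add: k_def real_vector.representation_scale)
    show "\<exists>K. \<forall>x. norm (k b x) \<le> norm x * K"
    proof (cases "b \<in> B")
      case True
      have "norm (k b x) \<le> norm x * C" for x
      proof -
        have "\<bar>k b x\<bar> \<le> (\<Sum>b\<in>B. \<bar>k b x\<bar>)"
          using True fin by (intro member_le_sum[where f="\<lambda>b. \<bar>k b x\<bar>"]) auto
        also have "\<dots> \<le> C * norm x" using C[of "\<lambda>b. k b x"] eq[of x] by simp
        finally show ?thesis by (simp add: mult.commute)
      qed
      then show ?thesis by blast
    next
      case False
      then have "k b x = 0" for x
        using real_vector.representation_ne_zero[of B x b] by (auto simp: k_def)
      then show ?thesis by (auto intro: exI[of _ 0])
    qed
  qed
  with fin eq show ?thesis using that by blast
qed

lemma linear_expand: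
  assumes "linear f" "v = (\<Sum>b\<in>B. k b v *\<^sub>R b)"
  shows "f v = (\<Sum>b\<in>B. k b v *\<^sub>R f b)"
proof -
  have "f v = f (\<Sum>b\<in>B. k b v *\<^sub>R b)" using assms(2) by simp
  also have "\<dots> = (\<Sum>b\<in>B. k b v *\<^sub>R f b)"
    using assms(1) by (simp add: linear_sum linear_scale)
  finally show ?thesis .
qed

text \<open>Expanding the second argument in a basis leaves finitely many bounded maps
  \<open>f _ b\<close>, whose bounds add up. So in that argument algebraic linearity is
  enough.\<close>

lemma fin_dim_bounded_bilinear:
  fixes f :: "'d::real_normed_vector \<Rightarrow> 'e::real_normed_vector \<Rightarrow> 'f::real_normed_vector"
  assumes "fin_dim TYPE('e)" "\<And>v. bounded_linear (\<lambda>u. f u v)" "\<And>u. linear (f u)"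
  shows "bounded_bilinear f"
proof -
  obtain B :: "'e set" and k where Bk: "finite B" "\<And>b. bounded_linear (k b)"
    "\<And>v. v = (\<Sum>b\<in>B. k b v *\<^sub>R b)"
    by (rule fin_dim_coordinates[OF assms(1)]) blast
  have "f u v = (\<Sum>b\<in>B. k b v *\<^sub>R f u b)" for u v
    using linear_expand[OF assms(3) Bk(3)] .
  note f_eq = this
  have "\<forall>b. \<exists>K. \<forall>u. norm (f u b) \<le> norm u * K"
    using bounded_linear.bounded[OF assms(2)] by blast
  then obtain K where K: "\<forall>b u. norm (f u b) \<le> norm u * K b"
    unfolding choice_iff by blast
  have "\<forall>b. \<exists>L. \<forall>v. norm (k b v) \<le> norm v * L"
    using bounded_linear.bounded[OF Bk(2)] by blast
  then obtain L where L: "\<forall>b v. norm (k b v) \<le> norm v * L b"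
    unfolding choice_iff by blast
  show ?thesis
  proof
    show "\<exists>C. \<forall>u v. norm (f u v) \<le> norm u * norm v * C"
    proof (intro exI allI)
      fix u v
      have "norm (f u v) \<le> (\<Sum>b\<in>B. norm (k b v *\<^sub>R f u b))"
        by (subst f_eq) (rule norm_sum)
      also have "\<dots> \<le> (\<Sum>b\<in>B. (norm v * L b) * (norm u * K b))"
        using K L order_trans[OF norm_ge_zero L[rule_format, of _ v]]
        by (intro sum_mono) (auto intro!: mult_mono)
      also have "\<dots> = norm u * norm v * (\<Sum>b\<in>B. L b * K b)"
        by (simp add: sum_distrib_left mult_ac)
      finally show "norm (f u v) \<le> norm u * norm v * (\<Sum>b\<in>B. L b * K b)" .
    qed
  qed (use assms(2,3) in \<open>auto simp: bounded_linear.linear linear_add linear_scale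
      dest: bounded_linear.linear[THEN linear_add] bounded_linear.linear[THEN linear_scale]\<close>)
qed

lemma fin_dim_prod:
  assumes "fin_dim TYPE('e::real_vector)" "fin_dim TYPE('f::real_vector)"
  shows "fin_dim TYPE('e \<times> 'f)"
proof -
  obtain B :: "'e set" and C :: "'f set"
    where BC: "finite B" "span B = UNIV" "finite C" "span C = UNIV"
    using assms by (auto simp: fin_dim_def)
  let ?D = "(\<lambda>b. (b, 0)) ` B \<union> (\<lambda>c. (0, c)) ` C"
  have lin: "linear (\<lambda>b::'e. (b, 0::'f))" "linear (\<lambda>c::'f. (0::'e, c))"
    by (auto intro!: linearI)
  have "(x, y) \<in> span ?D" for x y
  proof -
    have "(x, 0) \<in> span ((\<lambda>b. (b, 0::'f)) ` B)" "(0, y) \<in> span ((\<lambda>c. (0::'e, c)) ` C)"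
      using BC by (simp_all add: linear_span_image lin)
    then have "(x, 0) \<in> span ?D" "(0, y) \<in> span ?D"
      by (meson span_mono subsetD Un_upper1 Un_upper2)+
    then show ?thesis using span_add by fastforce
  qed
  then have "span ?D = UNIV" by auto
  then show ?thesis using BC unfolding fin_dim_def by (metis finite_UnI finite_imageI)
qed

subsection \<open>Calculus of \<open>k\<close> times differentiable maps\<close>

text \<open>No differentiability is assumed: the two functions have the same derivatives at
  \<open>x\<close>, if any, so the choice operator in \<open>frechet_derivative\<close> picks the
  same map.\<close>

lemma frechet_derivative_cong_open:
  assumes "open S" "x \<in> S" "\<And>x. x \<in> S \<Longrightarrow> f x = g x"
  shows "frechet_derivative f (at x) = frechet_derivative g (at x)"
proof -
  have "(f has_derivative D) (at x) \<longleftrightarrow> (g has_derivative D) (at x)" for D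
    using assms has_derivative_transform_within_open[of _ D x UNIV S]
    by (metis (full_types))
  then show ?thesis by (simp add: frechet_derivative_def)
qed

lemma Ck_on_subset: "Ck_on k T f \<Longrightarrow> S \<subseteq> T \<Longrightarrow> Ck_on k S f"
  by (induction k arbitrary: f) (auto intro: continuous_on_subset)

lemma Ck_on_cong:
  assumes "open S" "Ck_on k S f" "\<And>x. x \<in> S \<Longrightarrow> f x = g x"
  shows "Ck_on k S g"
  using assms(2,3)
proof (induction k arbitrary: f g)
  case 0
  then show ?case by (simp cong: continuous_on_cong)
next
  case (Suc k)
  have "g differentiable (at x)" if "x \<in> S" for x
    using Suc.prems that assms(1) has_derivative_transform_within_open[of f _ x UNIV S g]
    by (simp add: differentiable_def) blast
  moreover have "Ck_on k S (\<lambda>x. frechet_derivative g (at x) v)" for v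
  proof (rule Suc.IH)
    show "Ck_on k S (\<lambda>x. frechet_derivative f (at x) v)"
      using Suc.prems by simp
    show "frechet_derivative f (at x) v = frechet_derivative g (at x) v" if "x \<in> S" for x
      using frechet_derivative_cong_open[OF assms(1) that, of f g] Suc.prems(2) by presburger
  qed
  ultimately show ?case by simp
qed

text \<open>Allows an explicit derivative formula in place of \<open>frechet_derivative\<close>; the
  rules for sums, products and composites are proved through it.\<close>

lemma Ck_on_SucI:
  assumes "open S" "\<And>x. x \<in> S \<Longrightarrow> (f has_derivative f' x) (at x)"
    "\<And>v. Ck_on k S (\<lambda>x. f' x v)"
  shows "Ck_on (Suc k) S f"
proof -
  have "f' x = frechet_derivative f (at x)" if "x \<in> S" for x
    using assms(2) that frechet_derivative_at by blast
  then have "Ck_on k S (\<lambda>x. frechet_derivative f (at x) v)" for v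
    using Ck_on_cong[OF assms(1) assms(3)] by simp
  then show ?thesis using assms(2) by (auto simp: differentiable_def)
qed

lemma Ck_on_has_derivative:
  assumes "Ck_on (Suc k) S f" "x \<in> S"
  shows "(f has_derivative frechet_derivative f (at x)) (at x)"
  using assms frechet_derivative_works by auto

lemma Ck_on_SucD: "Ck_on (Suc k) S f \<Longrightarrow> Ck_on k S f"
proof (induction k arbitrary: f)
  case 0
  then show ?case
    using differentiable_imp_continuous_on[of f S]
    by (auto simp: differentiable_on_def intro: differentiable_at_withinI)
next
  case (Suc k)
  then show ?case by auto
qed

text \<open>Continuity and derivatives depend only on neighbourhoods. This permits an intermediate
  chart that varies with the point, as in \<open>smooth_map_compose_left\<close>.\<close>

lemma Ck_on_local:
  assumes "\<And>x. x \<in> S \<Longrightarrow> \<exists>T. open T \<and> x \<in> T \<and> Ck_on k T f"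
  shows "Ck_on k S f"
  using assms
proof (induction k arbitrary: f)
  case 0
  then show ?case
    by (metis Ck_on.simps(1) continuous_at_imp_continuous_on continuous_on_eq_continuous_at)
next
  case (Suc k)
  have "f differentiable (at x)" if "x \<in> S" for x
    using Suc.prems[OF that] by auto
  moreover have "Ck_on k S (\<lambda>x. frechet_derivative f (at x) v)" for v
    using Suc.prems by (intro Suc.IH) (metis Ck_on.simps(2))
  ultimately show ?case by simp
qed

lemma Ck_on_const: "open S \<Longrightarrow> Ck_on k S (\<lambda>x. c)"
proof (induction k arbitrary: c)
  case (Suc k)
  then show ?case by (intro Ck_on_SucI[where f'="\<lambda>x v. 0"]) auto
qed auto

lemma Ck_on_bounded_linear: "open S \<Longrightarrow> bounded_linear h \<Longrightarrow> Ck_on k S h"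
proof (cases k)
  case (Suc k)
  assume "open S" "bounded_linear h"
  then show ?thesis unfolding Suc
    by (intro Ck_on_SucI[where f'="\<lambda>x. h"] Ck_on_const bounded_linear_imp_has_derivative)
qed (simp add: linear_continuous_on)

lemma Ck_on_bounded_linear_compose:
  assumes "open S" "bounded_linear h" "Ck_on k S f"
  shows "Ck_on k S (\<lambda>x. h (f x))"
  using assms(3)
proof (induction k arbitrary: f)
  case 0
  then show ?case
    using bounded_linear.continuous_on[OF assms(2)] by simp
next
  case (Suc k)
  show ?case
    using Suc.prems
    by (intro Ck_on_SucI[OF assms(1), where f'="\<lambda>x v. h (frechet_derivative f (at x) v)"]
        bounded_linear.has_derivative[OF assms(2)] Ck_on_has_derivative[OF Suc.prems] Suc.IH) auto
qed

lemma Ck_on_add: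
  assumes "open S" "Ck_on k S f" "Ck_on k S g"
  shows "Ck_on k S (\<lambda>x. f x + g x)"
  using assms(2,3)
proof (induction k arbitrary: f g)
  case (Suc k)
  show ?case
    using Suc.prems
    by (intro Ck_on_SucI[OF assms(1), where
          f'="\<lambda>x v. frechet_derivative f (at x) v + frechet_derivative g (at x) v"]
        has_derivative_add Ck_on_has_derivative[OF Suc.prems(1)]
        Ck_on_has_derivative[OF Suc.prems(2)] Suc.IH) auto
qed (auto intro: continuous_intros)

lemma Ck_on_sum:
  assumes "open S" "\<And>i. i \<in> I \<Longrightarrow> Ck_on k S (f i)"
  shows "Ck_on k S (\<lambda>x. \<Sum>i\<in>I. f i x)"
  using assms(2)
proof (induction I rule: infinite_finite_induct)
  case (insert i I)
  then show ?case by (auto intro: Ck_on_add assms(1))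
qed (auto intro: Ck_on_const assms(1))

lemma Ck_on_scaleR:
  assumes "open S" "Ck_on k S f" "Ck_on k S g"
  shows "Ck_on k S (\<lambda>x. f x *\<^sub>R g x)"
  using assms(2,3)
proof (induction k arbitrary: f g)
  case (Suc k)
  show ?case
  proof (intro Ck_on_SucI[OF assms(1)] allI)
    fix x assume "x \<in> S"
    then show "((\<lambda>x. f x *\<^sub>R g x) has_derivative (\<lambda>v. f x *\<^sub>R frechet_derivative g (at x) v
      + frechet_derivative f (at x) v *\<^sub>R g x)) (at x)"
      by (intro has_derivative_scaleR Ck_on_has_derivative[OF Suc.prems(1)]
        Ck_on_has_derivative[OF Suc.prems(2)])
  next
    fix v
    show "Ck_on k S (\<lambda>x. f x *\<^sub>R frechet_derivative g (at x) v + frechet_derivative f (at x) v *\<^sub>R g x)"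
      using Suc.prems
      by (intro Ck_on_add assms(1) Suc.IH Ck_on_SucD[OF Suc.prems(1)] Ck_on_SucD[OF Suc.prems(2)])
        simp_all
  qed
qed (auto intro: continuous_intros)

lemma Ck_on_Pair:
  assumes "open S" "Ck_on k S f" "Ck_on k S g"
  shows "Ck_on k S (\<lambda>x. (f x, g x))"
proof -
  \<comment> \<open>The pair is the sum of two bounded linear images.\<close>
  have "bounded_linear (\<lambda>x::'b. (x, 0::'c))" "bounded_linear (\<lambda>y::'c. (0::'b, y))"
    by (auto intro!: bounded_linear_Pair bounded_linear_ident bounded_linear_zero)
  then have "Ck_on k S (\<lambda>x. (f x, 0) + (0, g x))"
    using assms by (intro Ck_on_add Ck_on_bounded_linear_compose[where h="\<lambda>x. (x, 0)"]
      Ck_on_bounded_linear_compose[where h="\<lambda>x. (0, x)"])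
  then show ?thesis by simp
qed

text \<open>\<open>Ck_on\<close> only controls one direction at a time, so the derivative of \<open>g\<close> is expanded in a
  basis of the middle space.\<close>

lemma Ck_on_compose:
  fixes f :: "'e::real_normed_vector \<Rightarrow> 'f::real_normed_vector"
    and g :: "'f \<Rightarrow> 'g::real_normed_vector"
  assumes fd: "fin_dim TYPE('f)" and S: "open S" and fST: "f ` S \<subseteq> T"
    and "Ck_on k S f" "Ck_on k T g"
  shows "Ck_on k S (\<lambda>x. g (f x))"
  using assms(4,5)
proof (induction k arbitrary: g)
  case 0
  then show ?case using continuous_on_compose2[OF _ _ fST, of g] by simp
next
  case (Suc k)
  obtain B :: "'f set" and k' where B: "finite B" "\<And>b. bounded_linear (k' b)"
    "\<And>v. v = (\<Sum>b\<in>B. k' b v *\<^sub>R b)"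
    by (rule fin_dim_coordinates[OF fd]) blast
  define f' where "f' x = frechet_derivative f (at x)" for x
  define g' where "g' x = frechet_derivative g (at x)" for x
  have f': "(f has_derivative f' x) (at x)" if "x \<in> S" for x
    using Ck_on_has_derivative[OF Suc.prems(1) that] by (simp add: f'_def)
  have g': "(g has_derivative g' (f x)) (at (f x))" if "x \<in> S" for x
    using Ck_on_has_derivative[OF Suc.prems(2), of "f x"] that fST by (auto simp: g'_def)
  show ?case
  proof (rule Ck_on_SucI[OF S])
    fix x assume x: "x \<in> S"
    have "linear (g' (f x))" using g'[OF x] has_derivative_linear by blast
    then have "(\<lambda>v. g' (f x) (f' x v)) = (\<lambda>v. \<Sum>b\<in>B. k' b (f' x v) *\<^sub>R g' (f x) b)"
      using linear_expand B(3) by blast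
    then show "((\<lambda>x. g (f x)) has_derivative (\<lambda>v. \<Sum>b\<in>B. k' b (f' x v) *\<^sub>R g' (f x) b)) (at x)"
      using diff_chain_at[OF f'[OF x] g'[OF x]] by (simp add: o_def)
  next
    fix v
    show "Ck_on k S (\<lambda>x. \<Sum>b\<in>B. k' b (f' x v) *\<^sub>R g' (f x) b)"
    proof (intro Ck_on_sum S Ck_on_scaleR)
      fix b
      show "Ck_on k S (\<lambda>x. k' b (f' x v))"
        using Suc.prems(1) by (intro Ck_on_bounded_linear_compose[OF S B(2)]) (simp add: f'_def)
      show "Ck_on k S (\<lambda>x. g' (f x) b)"
        \<comment> \<open>The induction is over all \<open>g\<close>, so its hypothesis applies to
          the directional derivative of \<open>g\<close> along \<open>b\<close>, with
          \<open>f\<close> used at one order less.\<close>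
        using Suc.prems(2) Suc.IH[OF Ck_on_SucD[OF Suc.prems(1)], of "\<lambda>y. g' y b"]
        by (simp add: g'_def)
    qed
  qed
qed


subsection \<open>Charts, tangent vectors and differentials\<close>

lemma charts_atD:
  assumes "c \<in> charts_at M p"
  shows "c \<in> atlas M" "p \<in> fst c"
  using assms by (auto simp: charts_at_def)

lemma chart_inv_in: "y \<in> snd c ` fst c \<Longrightarrow> chart_inv c y \<in> fst c"
  unfolding chart_inv_def by (rule inv_into_into)

lemma chart_chart_inv: "y \<in> snd c ` fst c \<Longrightarrow> snd c (chart_inv c y) = y"
  unfolding chart_inv_def by (rule f_inv_into_f)

context
  fixes M :: "('a, 'e::real_normed_vector) manifold" and c :: "('a, 'e) chart"
  assumes M: "smooth_manifold M" and c: "c \<in> atlas M"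
begin

lemma chart_homeomorphic:
  "openin (mtop M) (fst c)" "open (snd c ` fst c)"
  "homeomorphic_map (subtopology (mtop M) (fst c)) (top_of_set (snd c ` fst c)) (snd c)"
  using M c unfolding smooth_manifold_def case_prod_unfold by (auto simp: prod.collapse)

lemma chart_subset: "fst c \<subseteq> points M"
  using chart_homeomorphic(1) openin_subset by blast

lemma chart_inj: "inj_on (snd c) (fst c)"
  using homeomorphic_imp_injective_map[OF chart_homeomorphic(3)] chart_subset
  by (simp add: Int_absorb1)

lemma chart_inv_chart: "x \<in> fst c \<Longrightarrow> chart_inv c (snd c x) = x"
  unfolding chart_inv_def using chart_inj by simp

lemma open_chart_image:
  assumes "openin (mtop M) W"
  shows "open (snd c ` (fst c \<inter> W))"
proof -
  have "openin (subtopology (mtop M) (fst c)) (fst c \<inter> W)"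
    using assms by (simp add: openin_subtopology_Int2)
  then have "openin (top_of_set (snd c ` fst c)) (snd c ` (fst c \<inter> W))"
    using homeomorphic_imp_open_map[OF chart_homeomorphic(3)] by (simp add: open_map_def)
  then show ?thesis using chart_homeomorphic(2) openin_open_trans by blast
qed

lemma transition_smooth:
  "d \<in> atlas M \<Longrightarrow> smooth_on (snd c ` (fst c \<inter> fst d)) (snd d \<circ> chart_inv c)"
  using M c unfolding smooth_manifold_def case_prod_unfold by simp

end

lemma ex_chart:
  assumes "smooth_manifold M" "p \<in> points M"
  obtains c where "c \<in> charts_at M p"
  using assms unfolding smooth_manifold_def charts_at_def by blast

lemma fin_dim_manifold:
  fixes M :: "('a, 'e::real_normed_vector) manifold"
  shows "smooth_manifold M \<Longrightarrow> fin_dim TYPE('e)"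
  by (simp add: smooth_manifold_def fin_dim_def)

lemma smooth_mapD:
  assumes "smooth_map M N f"
  shows "continuous_map (mtop M) (mtop N) f"
    "c \<in> atlas M \<Longrightarrow> d \<in> atlas N \<Longrightarrow>
      smooth_on (snd c ` (fst c \<inter> f -` fst d)) (snd d \<circ> f \<circ> chart_inv c)"
  using assms unfolding smooth_map_def case_prod_unfold by simp_all

lemma open_chart_preimage:
  assumes "smooth_manifold M" "smooth_manifold N" "continuous_map (mtop M) (mtop N) f"
    "c \<in> atlas M" "d \<in> atlas N"
  shows "open (snd c ` (fst c \<inter> f -` fst d))"
proof -
  have "openin (mtop M) {x \<in> points M. f x \<in> fst d}"
    using assms chart_homeomorphic(1) by (blast intro: openin_continuous_map_preimage)
  moreover have "fst c \<inter> f -` fst d = fst c \<inter> {x \<in> points M. f x \<in> fst d}"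
    using chart_subset[OF assms(1,4)] by auto
  ultimately show ?thesis using open_chart_image[OF assms(1,4)] by simp
qed

lemma smooth_onD:
  assumes "smooth_on S f" "x \<in> S"
  shows "f differentiable (at x)"
  using assms Ck_on.simps(2)[of 0 S f] unfolding smooth_on_def by blast

text \<open>Weaker than \<open>smooth_map\<close> and confined to one point. This is all that
  \<open>differential\<close> needs, and it is what is shown for the left multiplications
  \<open>r p\<close> at \<open>e\<close>.\<close>

definition chart_differentiable ::
  "('a, 'e::real_normed_vector) manifold \<Rightarrow> ('b, 'f::real_normed_vector) manifold
    \<Rightarrow> ('a \<Rightarrow> 'b) \<Rightarrow> 'a \<Rightarrow> bool" where
  "chart_differentiable M N f p \<longleftrightarrow>
     (\<forall>c\<in>charts_at M p. \<forall>d\<in>charts_at N (f p).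
        (snd d \<circ> f \<circ> chart_inv c) differentiable (at (snd c p)))"

lemma chart_differentiableD:
  assumes "chart_differentiable M N f p" "c \<in> charts_at M p" "d \<in> charts_at N (f p)"
  shows "(snd d \<circ> f \<circ> chart_inv c has_derivative
    frechet_derivative (snd d \<circ> f \<circ> chart_inv c) (at (snd c p))) (at (snd c p))"
  using assms frechet_derivative_works unfolding chart_differentiable_def by blast

lemma smooth_map_chart_differentiable:
  assumes "smooth_map M N f"
  shows "chart_differentiable M N f p"
  unfolding chart_differentiable_def
proof (intro ballI)
  fix c d assume cd: "c \<in> charts_at M p" "d \<in> charts_at N (f p)"
  note c = charts_atD[OF cd(1)] and d = charts_atD[OF cd(2)]
  show "(snd d \<circ> f \<circ> chart_inv c) differentiable (at (snd c p))"
    using c d by (intro smooth_onD[OF smooth_mapD(2)[OF assms c(1) d(1)]]) auto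
qed

lemma transition_has_derivative:
  assumes "smooth_manifold M" "c \<in> charts_at M p" "d \<in> charts_at M p"
  shows "(snd d \<circ> chart_inv c has_derivative
    frechet_derivative (snd d \<circ> chart_inv c) (at (snd c p))) (at (snd c p))"
proof -
  note c = charts_atD[OF assms(2)] and d = charts_atD[OF assms(3)]
  show ?thesis unfolding frechet_derivative_works[symmetric]
    using c d by (intro smooth_onD[OF transition_smooth[OF assms(1) c(1) d(1)]]) auto
qed

text \<open>The chain rule through a chart \<open>d\<close> at \<open>f p\<close>. The two
  coordinate expressions agree only where \<open>f\<close> lands in the domain of \<open>d\<close>,
  an open set by continuity. The target of \<open>h\<close> is any normed space, so coordinate maps
  and functions such as \<open>\<lambda>p. theta p v\<close> are both covered.\<close>

lemma has_derivative_chart_compose: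
  fixes h :: "'b \<Rightarrow> 'g::real_normed_vector"
  assumes MN: "smooth_manifold M" "smooth_manifold N"
    and f: "continuous_map (mtop M) (mtop N) f"
    and cd: "c \<in> charts_at M p" "d \<in> charts_at N (f p)"
    and F: "(snd d \<circ> f \<circ> chart_inv c has_derivative F) (at (snd c p))"
    and G: "(h \<circ> chart_inv d has_derivative G) (at (snd d (f p)))"
  shows "(h \<circ> f \<circ> chart_inv c has_derivative G \<circ> F) (at (snd c p))"
proof (rule has_derivative_transform_within_open)
  note c = charts_atD[OF cd(1)] and d = charts_atD[OF cd(2)]
  note inv = chart_inv_chart[OF MN(1) c(1)] chart_inv_chart[OF MN(2) d(1)]
  have eq: "(snd d \<circ> f \<circ> chart_inv c) (snd c p) = snd d (f p)"
    using c inv by simp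
  then show "((h \<circ> chart_inv d) \<circ> (snd d \<circ> f \<circ> chart_inv c) has_derivative G \<circ> F) (at (snd c p))"
    using diff_chain_at[OF F, of "h \<circ> chart_inv d" G] G unfolding eq by blast
  show "open (snd c ` (fst c \<inter> f -` fst d))"
    using MN f c d by (intro open_chart_preimage)
  show "snd c p \<in> snd c ` (fst c \<inter> f -` fst d)" using c d by blast
  show "((h \<circ> chart_inv d) \<circ> (snd d \<circ> f \<circ> chart_inv c)) x = (h \<circ> f \<circ> chart_inv c) x"
    if "x \<in> snd c ` (fst c \<inter> f -` fst d)" for x
    using that inv by auto
qed

section \<open>Tangent vectors in the coordinates of one chart\<close>

definition tvec ::
  "('a, 'e::real_normed_vector) manifold \<Rightarrow> 'a \<Rightarrow> ('a, 'e) chart \<Rightarrow> 'e \<Rightarrow> ('a, 'e) tangent_vector" where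
  "tvec M p c u =
     (\<lambda>d. if d \<in> charts_at M p then frechet_derivative (snd d \<circ> chart_inv c) (at (snd c p)) u else 0)"

context
  fixes M :: "('a, 'e::real_normed_vector) manifold" and p :: 'a and c :: "('a, 'e) chart"
  assumes M: "smooth_manifold M" and c: "c \<in> charts_at M p"
begin

text \<open>Change of chart in the source, obtained from the chain rule with \<open>id\<close> as
  the inner map.\<close>

lemma frechet_derivative_chart:
  "frechet_derivative (h \<circ> chart_inv d) (at (snd d p)) (frechet_derivative (snd d \<circ> chart_inv c) (at (snd c p)) u)
    = frechet_derivative (h \<circ> chart_inv c) (at (snd c p)) u"
  if "d \<in> charts_at M p" "(h \<circ> chart_inv d) differentiable (at (snd d p))"
  for h :: "'a \<Rightarrow> 'g::real_normed_vector"
proof -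
  have "(h \<circ> id \<circ> chart_inv c has_derivative frechet_derivative (h \<circ> chart_inv d) (at (snd d p))
      \<circ> frechet_derivative (snd d \<circ> chart_inv c) (at (snd c p))) (at (snd c p))"
    using transition_has_derivative[OF M c that(1)] that c M
    by (intro has_derivative_chart_compose[where d=d and M=M and N=M])
      (auto simp: frechet_derivative_works[symmetric])
  from frechet_derivative_at[OF this] show ?thesis by (simp add: fun_eq_iff o_def)
qed

lemma tvec_in_tangent_space: "tvec M p c u \<in> tangent_space M p"
  unfolding tangent_space_def
proof (intro CollectI conjI ballI allI impI)
  fix d d' assume d: "d \<in> charts_at M p" and d': "d' \<in> charts_at M p"
  have "(snd d' \<circ> chart_inv d) differentiable (at (snd d p))"
    using transition_has_derivative[OF M d d'] by (simp add: frechet_derivative_works)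
  from frechet_derivative_chart[OF d this]
  show "tvec M p c u d' = frechet_derivative (snd d' \<circ> chart_inv d) (at (snd d p)) (tvec M p c u d)"
    using d d' by (simp add: tvec_def)
qed (simp add: tvec_def)

lemma frechet_derivative_self_chart:
  "frechet_derivative (snd c \<circ> chart_inv c) (at (snd c p)) = id"
proof -
  have "frechet_derivative (snd c \<circ> chart_inv c) (at (snd c p)) = frechet_derivative id (at (snd c p))"
    using charts_atD[OF c] chart_homeomorphic(2)[OF M]
    by (intro frechet_derivative_cong_open[of "snd c ` fst c"]) (auto simp: chart_chart_inv)
  also have "\<dots> = id"
    using frechet_derivative_at[OF has_derivative_id, of "snd c p"] by (simp add: id_def)
  finally show ?thesis .
qed

lemma tvec_chart [simp]: "tvec M p c u c = u"
  using c by (simp add: tvec_def frechet_derivative_self_chart)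

text \<open>With \<open>tvec_chart\<close>, this makes \<open>tvec M p c\<close> and evaluation at
  \<open>c\<close> inverse to each other, so a tangent vector is determined by its coordinates in a
  single chart. Both sides vanish on charts away from \<open>p\<close>.\<close>

lemma tvec_coordinate [simp]: "v \<in> tangent_space M p \<Longrightarrow> tvec M p c (v c) = v"
proof (rule ext)
  fix d assume v: "v \<in> tangent_space M p"
  show "tvec M p c (v c) d = v d"
  proof (cases "d \<in> charts_at M p")
    case True
    with v c have "v d = frechet_derivative (snd d \<circ> chart_inv c) (at (snd c p)) (v c)"
      unfolding tangent_space_def by blast
    with True show ?thesis by (simp only: tvec_def if_True)
  next
    case False
    with v have "v d = 0" unfolding tangent_space_def by blast
    with False show ?thesis by (simp add: tvec_def)
  qed
qed

lemma linear_tvec: "linear (tvec M p c)"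
proof (rule linearI)
  have lin: "linear (frechet_derivative (snd d \<circ> chart_inv c) (at (snd c p)))"
    if "d \<in> charts_at M p" for d
    using transition_has_derivative[OF M c that] by (rule has_derivative_linear)
  show "tvec M p c (u + v) = tvec M p c u + tvec M p c v" for u v
    unfolding tvec_def plus_fun_def by (rule ext) (simp add: linear_add[OF lin])
  show "tvec M p c (r *\<^sub>R u) = r *\<^sub>R tvec M p c u" for r u
    unfolding tvec_def scaleR_fun_def by (rule ext) (simp add: linear_scale[OF lin])
qed

text \<open>The tangent space is the image of the linear map \<open>tvec M p c\<close>.\<close>

lemma subspace_tangent_space: "subspace (tangent_space M p)"
  proof (rule subspaceI)
  show "0 \<in> tangent_space M p"
    using tvec_in_tangent_space[of 0] linear_0[OF linear_tvec] by simp
  show "v + w \<in> tangent_space M p" if "v \<in> tangent_space M p" "w \<in> tangent_space M p" for v w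
    using that tvec_in_tangent_space[of "v c + w c"] by (simp add: linear_add[OF linear_tvec])
  show "r *\<^sub>R v \<in> tangent_space M p" if "v \<in> tangent_space M p" for r v
    using that tvec_in_tangent_space[of "r *\<^sub>R v c"] by (simp add: linear_scale[OF linear_tvec])
qed

end

text \<open>The definition constrains all pairs of charts at once. One pair already fixes the
  candidate, which gives uniqueness; the chain rule shows that this candidate satisfies the other
  constraints.\<close>

lemma differential_eq_tvec:
  fixes M :: "('a, 'e::real_normed_vector) manifold" and N :: "('b, 'f::real_normed_vector) manifold"
  assumes M: "smooth_manifold M" and N: "smooth_manifold N" and c: "c \<in> charts_at M p" and f: "continuous_map (mtop M) (mtop N) f" "chart_differentiable M N f p"
    and d: "d \<in> charts_at N (f p)" and v: "v \<in> tangent_space M p"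
  shows "differential M N f p v =
    tvec N (f p) d (frechet_derivative (snd d \<circ> f \<circ> chart_inv c) (at (snd c p)) (v c))"
  unfolding differential_def
proof (rule the_equality)
  let ?w = "frechet_derivative (snd d \<circ> f \<circ> chart_inv c) (at (snd c p)) (v c)"
  show "tvec N (f p) d ?w \<in> tangent_space N (f p) \<and> (\<forall>c\<in>charts_at M p. \<forall>d'\<in>charts_at N (f p).
    tvec N (f p) d ?w d' = frechet_derivative (snd d' \<circ> f \<circ> chart_inv c) (at (snd c p)) (v c))"
  proof (intro conjI ballI)
    show "tvec N (f p) d ?w \<in> tangent_space N (f p)"
      by (rule tvec_in_tangent_space[OF N d])
  next
    fix c' d' assume c': "c' \<in> charts_at M p" and d': "d' \<in> charts_at N (f p)"
    have vc': "frechet_derivative (snd c' \<circ> chart_inv c) (at (snd c p)) (v c) = v c'"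
      by (rule sym) (use v c c' in \<open>unfold tangent_space_def, blast\<close>)
    \<comment> \<open>First the target chart is changed from \<open>d\<close> to
      \<open>d'\<close>.\<close>
    have "(snd d' \<circ> f \<circ> chart_inv c has_derivative frechet_derivative (snd d' \<circ> chart_inv d) (at (snd d (f p)))
        \<circ> frechet_derivative (snd d \<circ> f \<circ> chart_inv c) (at (snd c p))) (at (snd c p))"
      by (rule has_derivative_chart_compose[OF M N f(1) c d chart_differentiableD[OF f(2) c d]
            transition_has_derivative[OF N d d']])
    from frechet_derivative_at[OF this]
    have "frechet_derivative (snd d' \<circ> chart_inv d) (at (snd d (f p))) ?w
        = frechet_derivative (snd d' \<circ> f \<circ> chart_inv c) (at (snd c p)) (v c)"
      by (simp add: fun_eq_iff)
    \<comment> \<open>Then the source chart is changed from \<open>c\<close> to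
      \<open>c'\<close>.\<close>
    also have "\<dots> = frechet_derivative (snd d' \<circ> f \<circ> chart_inv c') (at (snd c' p))
        (frechet_derivative (snd c' \<circ> chart_inv c) (at (snd c p)) (v c))"
      using f(2) c' d' by (intro frechet_derivative_chart[OF M c, symmetric]) (auto simp: chart_differentiable_def)
    finally show "tvec N (f p) d ?w d' = frechet_derivative (snd d' \<circ> f \<circ> chart_inv c') (at (snd c' p)) (v c')"
      using d' unfolding vc' by (simp only: tvec_def if_True)
  qed
next
  fix w assume w: "w \<in> tangent_space N (f p) \<and> (\<forall>c\<in>charts_at M p. \<forall>d\<in>charts_at N (f p).
      w d = frechet_derivative (snd d \<circ> f \<circ> chart_inv c) (at (snd c p)) (v c))"
  then show "w = tvec N (f p) d (frechet_derivative (snd d \<circ> f \<circ> chart_inv c) (at (snd c p)) (v c))"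
    using c d tvec_coordinate[OF N d] by metis
qed


subsection \<open>Products of manifolds and the descendent rack\<close>

definition prod_chart :: "('a, 'e) chart \<Rightarrow> ('b, 'f) chart \<Rightarrow> ('a \<times> 'b, 'e \<times> 'f) chart" where
  "prod_chart c d = (fst c \<times> fst d, map_prod (snd c) (snd d))"

lemma prod_chart_simps [simp]:
  "fst (prod_chart c d) = fst c \<times> fst d" "snd (prod_chart c d) = map_prod (snd c) (snd d)"
  by (simp_all add: prod_chart_def)

lemma atlas_prod_manifold:
  "atlas (prod_manifold M N) = {prod_chart c d |c d. c \<in> atlas M \<and> d \<in> atlas N}"
  by (force simp: prod_manifold_def prod_chart_def)

lemma mtop_prod_manifold [simp]: "mtop (prod_manifold M N) = prod_topology (mtop M) (mtop N)"
  by (simp add: prod_manifold_def)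

context
  fixes M :: "('a, 'e::real_normed_vector) manifold" and N :: "('b, 'f::real_normed_vector) manifold"
    and c :: "('a, 'e) chart" and d :: "('b, 'f) chart"
  assumes M: "smooth_manifold M" and N: "smooth_manifold N"
    and c: "c \<in> atlas M" and d: "d \<in> atlas N"
begin

lemma chart_inv_prod_chart:
  assumes "x \<in> snd c ` fst c" "y \<in> snd d ` fst d"
  shows "chart_inv (prod_chart c d) (x, y) = (chart_inv c x, chart_inv d y)"
proof -
  have "inj_on (map_prod (snd c) (snd d)) (fst c \<times> fst d)"
    by (intro map_prod_inj_on chart_inj[OF M c] chart_inj[OF N d])
  from inv_into_f_f[OF this, of "(chart_inv c x, chart_inv d y)"] show ?thesis
    using assms by (simp add: chart_inv_def[of "prod_chart c d"] chart_chart_inv chart_inv_in)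
qed

text \<open>The product manifold is handled through its factors: a point of \<open>W\<close> has a
  box neighbourhood inside \<open>W\<close>, and the factor charts send its sides to open
  sets.\<close>

lemma open_prod_chart_image:
  assumes "openin (prod_topology (mtop M) (mtop N)) W"
  shows "open (map_prod (snd c) (snd d) ` ((fst c \<times> fst d) \<inter> W))"
proof (rule open_prod_intro)
  fix z assume "z \<in> map_prod (snd c) (snd d) ` ((fst c \<times> fst d) \<inter> W)"
  then obtain p q where z: "z = (snd c p, snd d q)" "p \<in> fst c" "q \<in> fst d" "(p, q) \<in> W"
    by auto
  have "\<exists>U V. openin (mtop M) U \<and> openin (mtop N) V \<and> p \<in> U \<and> q \<in> V \<and> U \<times> V \<subseteq> W"
    using assms[unfolded openin_prod_topology_alt, rule_format, OF z(4)] .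
  then obtain U V where UV: "openin (mtop M) U" "openin (mtop N) V" "p \<in> U" "q \<in> V" "U \<times> V \<subseteq> W"
    by blast
  show "\<exists>S T. open S \<and> open T \<and> z \<in> S \<times> T
      \<and> S \<times> T \<subseteq> map_prod (snd c) (snd d) ` ((fst c \<times> fst d) \<inter> W)"
  proof (intro exI conjI)
    show "open (snd c ` (fst c \<inter> U))" "open (snd d ` (fst d \<inter> V))"
      using open_chart_image[OF M c] open_chart_image[OF N d] UV by blast+
    show "z \<in> snd c ` (fst c \<inter> U) \<times> snd d ` (fst d \<inter> V)" using z UV by blast
    show "snd c ` (fst c \<inter> U) \<times> snd d ` (fst d \<inter> V)
      \<subseteq> map_prod (snd c) (snd d) ` ((fst c \<times> fst d) \<inter> W)"
    proof clarify
      fix x y assume "x \<in> fst c" "x \<in> U" "y \<in> fst d" "y \<in> V"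
      then have "map_prod (snd c) (snd d) (x, y) \<in> map_prod (snd c) (snd d) ` ((fst c \<times> fst d) \<inter> W)"
        using UV by (intro imageI) auto
      then show "(snd c x, snd d y) \<in> map_prod (snd c) (snd d) ` ((fst c \<times> fst d) \<inter> W)" by simp
    qed
  qed
qed

end

text \<open>Gives smoothness of the descendent operation, with \<open>A\<close> for \<open>f\<close>
  and the rack operation for \<open>g\<close>. In coordinates the map factors as \<open>F\<close>,
  which is \<open>f\<close> times the identity, followed by \<open>H\<close>, which represents
  \<open>g\<close>.\<close>

lemma smooth_map_compose_left:
  fixes L :: "('l, 'x::real_normed_vector) manifold" and M :: "('m, 'y::real_normed_vector) manifold"
    and N :: "('n, 'z::real_normed_vector) manifold" and P :: "('p, 'w::real_normed_vector) manifold"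
  assumes man: "smooth_manifold L" "smooth_manifold M" "smooth_manifold N" "smooth_manifold P"
    and f: "smooth_map L M f" and g: "smooth_map (prod_manifold M N) P g"
  shows "smooth_map (prod_manifold L N) P (\<lambda>z. g (f (fst z), snd z))"
  unfolding smooth_map_def
proof (intro conjI ballI, goal_cases)
  case 1
  have "continuous_map (prod_topology (mtop L) (mtop N)) (prod_topology (mtop M) (mtop N))
      (\<lambda>z. ((f \<circ> fst) z, snd z))"
    using continuous_map_compose[OF continuous_map_fst smooth_mapD(1)[OF f]]
    by (intro continuous_map_pairedI continuous_map_snd)
  from continuous_map_compose[OF this] show ?case
    using smooth_mapD(1)[OF g] by (simp add: o_def)
next
  case (2 ab)
  then obtain a b where ab: "ab = prod_chart a b" and a: "a \<in> atlas L" and b: "b \<in> atlas N"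
    unfolding atlas_prod_manifold by blast
  let ?G = "\<lambda>z. g (f (fst z), snd z)"
  have "Ck_on k (snd ab ` (fst ab \<inter> ?G -` fst d)) (snd d \<circ> ?G \<circ> chart_inv ab)"
    if d: "d \<in> atlas P" for k d
  proof (rule Ck_on_local)
    fix z assume "z \<in> snd ab ` (fst ab \<inter> ?G -` fst d)"
    then obtain p q where z: "z = (snd a p, snd b q)" "p \<in> fst a" "q \<in> fst b" "g (f p, q) \<in> fst d"
      unfolding ab by auto
    have "f p \<in> points M"
      using z(2) chart_subset[OF man(1) a] smooth_mapD(1)[OF f] by (auto simp: continuous_map_def)
    \<comment> \<open>The chart around \<open>f p\<close> depends on the chosen point, hence the
      local argument.\<close>
    then obtain a' where "a' \<in> charts_at M (f p)" by (rule ex_chart[OF man(2)])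
    note a' = charts_atD[OF this]
    define H where "H = snd d \<circ> g \<circ> chart_inv (prod_chart a' b)"
    define F where "F = (\<lambda>z. ((snd a' \<circ> f \<circ> chart_inv a) (fst z), snd z :: 'z))"
    define T0 where "T0 = (snd a ` (fst a \<inter> f -` fst a')) \<times> (snd b ` fst b)"
    define S where "S = map_prod (snd a') (snd b) ` ((fst a' \<times> fst b) \<inter> g -` fst d)"
    have "openin (prod_topology (mtop M) (mtop N)) {z \<in> topspace (prod_topology (mtop M) (mtop N)). g z \<in> fst d}"
      using smooth_mapD(1)[OF g] chart_homeomorphic(1)[OF man(4) d]
      by (intro openin_continuous_map_preimage) auto
    note open_prod_chart_image[OF man(2,3) a'(1) b this]
    moreover have "(fst a' \<times> fst b) \<inter> {z \<in> topspace (prod_topology (mtop M) (mtop N)). g z \<in> fst d}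
        = (fst a' \<times> fst b) \<inter> g -` fst d"
      using chart_subset[OF man(2) a'(1)] chart_subset[OF man(3) b] by auto
    ultimately have S: "open S" unfolding S_def by simp
    have T0: "open T0" unfolding T0_def
      using open_chart_preimage[OF man(1,2) smooth_mapD(1)[OF f] a a'(1)] chart_homeomorphic(2)[OF man(3) b]
      by (rule open_Times)
    have F_Ck: "Ck_on k T0 F" for k
      unfolding F_def
    proof (intro Ck_on_Pair T0)
      have "Ck_on k (snd a ` (fst a \<inter> f -` fst a')) (snd a' \<circ> f \<circ> chart_inv a)"
        using smooth_mapD(2)[OF f a a'(1)] by (simp add: smooth_on_def)
      moreover have "fst ` T0 \<subseteq> snd a ` (fst a \<inter> f -` fst a')" by (auto simp: T0_def)
      ultimately show "Ck_on k T0 (\<lambda>z. (snd a' \<circ> f \<circ> chart_inv a) (fst z))"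
        using Ck_on_compose[OF fin_dim_manifold[OF man(1)] T0] Ck_on_bounded_linear[OF T0 bounded_linear_fst]
        by blast
      show "Ck_on k T0 snd" by (rule Ck_on_bounded_linear[OF T0 bounded_linear_snd])
    qed
    \<comment> \<open>\<open>T0\<close> keeps \<open>f\<close> inside the chart \<open>a'\<close>;
      intersecting with the preimage of \<open>S\<close> also puts the value of \<open>g\<close> in
      the chart \<open>d\<close>.\<close>
    define T where "T = T0 \<inter> F -` S"
    have T: "open T" unfolding T_def
      using F_Ck[of 0] by (intro continuous_open_preimage T0 S) simp
    have "prod_chart a' b \<in> atlas (prod_manifold M N)"
      using a' b unfolding atlas_prod_manifold by blast
    from smooth_mapD(2)[OF g this d] have "Ck_on k S H"
      by (simp add: smooth_on_def S_def H_def)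
    moreover have "F ` T \<subseteq> S" "Ck_on k T F" using Ck_on_subset[OF F_Ck] by (auto simp: T_def)
    ultimately have "Ck_on k T (\<lambda>z. H (F z))"
      using Ck_on_compose[OF fin_dim_prod[OF fin_dim_manifold[OF man(2)] fin_dim_manifold[OF man(3)]] T]
      by blast
    then have "Ck_on k T (snd d \<circ> ?G \<circ> chart_inv ab)"
    proof (rule Ck_on_cong[OF T])
      fix z assume "z \<in> T"
      then obtain x y where xy: "z = (snd a x, snd b y)" "x \<in> fst a" "f x \<in> fst a'" "y \<in> fst b"
        by (auto simp: T_def T0_def)
      then show "H (F z) = (snd d \<circ> ?G \<circ> chart_inv ab) z"
        using chart_inv_prod_chart[OF man(1,3) a b, of "snd a x" "snd b y"]
          chart_inv_prod_chart[OF man(2,3) a'(1) b, of "snd a' (f x)" "snd b y"]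
        by (simp add: H_def F_def ab chart_inv_chart[OF man(1) a] chart_inv_chart[OF man(3) b]
            chart_inv_chart[OF man(2) a'(1)])
    qed
    moreover have "z \<in> T"
      using z a' by (auto simp: T_def T0_def S_def F_def chart_inv_chart[OF man(1) a]
          intro!: image_eqI[of _ "map_prod (snd a') (snd b)" "(f p, q)"])
    ultimately show "\<exists>T. open T \<and> z \<in> T \<and> Ck_on k T (snd d \<circ> ?G \<circ> chart_inv ab)"
      using T by blast
  qed
  then show ?case by (cases ab) (auto simp: smooth_on_def)
qed

text \<open>Self-distributivity of \<open>r\<close> at \<open>A x\<close>, \<open>A y\<close>,
  \<open>z\<close> becomes that of the descendent operation once \<open>r (A x) (A y)\<close> is
  rewritten by the averaging identity. Unique solvability is that of \<open>r\<close> at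
  \<open>A x\<close>.\<close>

lemma pointed_Lie_rack_descendent:
  assumes "pointed_Lie_rack Q r e" "smooth_pointed_averaging_operator Q r e A"
  shows "pointed_Lie_rack Q (descendent r A) e"
proof -
  have Q: "smooth_manifold Q" "rack (points Q) r" "smooth_map (prod_manifold Q Q) Q (\<lambda>(x, y). r x y)"
    "e \<in> points Q" "\<forall>x\<in>points Q. r x e = e \<and> r e x = x"
    using assms(1) by (simp_all add: pointed_Lie_rack_def)
  have A: "smooth_map Q Q A" "A e = e" "\<forall>x\<in>points Q. \<forall>y\<in>points Q. r (A x) (A y) = A (r (A x) y)"
    using assms(2) by (simp_all add: smooth_pointed_averaging_operator_def)
  have A_in: "A x \<in> points Q" if "x \<in> points Q" for x
    using that smooth_mapD(1)[OF A(1)] by (auto simp: continuous_map_def)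
  have "smooth_map (prod_manifold Q Q) Q (\<lambda>(x, y). descendent r A x y)"
    using smooth_map_compose_left[OF Q(1,1,1,1) A(1) Q(3)]
    by (simp add: descendent_def[abs_def] case_prod_unfold)
  moreover have "rack (points Q) (descendent r A)"
    unfolding rack_def descendent_def
  proof (intro conjI ballI)
    fix x y z assume xyz: "x \<in> points Q" "y \<in> points Q" "z \<in> points Q"
    have "r (A x) (r (A y) z) = r (r (A x) (A y)) (r (A x) z)"
      using Q(2) A_in xyz unfolding rack_def by blast
    then show "r (A x) (r (A y) z) = r (A (r (A x) y)) (r (A x) z)"
      using A(3) xyz by simp
  qed (use Q(2) A_in in \<open>auto simp: rack_def\<close>)
  ultimately show ?thesis
    using Q A(2) A_in unfolding pointed_Lie_rack_def by (simp add: descendent_def[abs_def])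
qed


subsection \<open>The tangent Leibniz algebra\<close>

lemma sum_fun_apply [simp]: "(\<Sum>i\<in>I. f i) x = (\<Sum>i\<in>I. f i x)"
  for f :: "'i \<Rightarrow> 'a \<Rightarrow> 'b::comm_monoid_add"
  by (induction I rule: infinite_finite_induct) auto

lemma scaleR_fun_apply [simp]: "(r *\<^sub>R f) x = r *\<^sub>R f x"
  by (simp add: scaleR_fun_def)

text \<open>A nonzero difference extends to a basis, so some linear functional is 1 on it. This
  yields uniqueness in \<open>vector_differential\<close>, which tests its value only against linear
  functionals.\<close>

lemma linear_functional_eqI:
  fixes v w :: "'v::real_vector"
  assumes "\<And>l::'v \<Rightarrow> real. linear l \<Longrightarrow> l v = l w"
  shows "v = w"
proof (rule ccontr)
  assume "v \<noteq> w"
  then have "independent {v - w}" by simp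
  then obtain l :: "'v \<Rightarrow> real" where "linear l" "l (v - w) = 1"
    using linear_independent_extend[of "{v - w}" "\<lambda>_. 1"] by auto
  with assms[of l] show False by (simp add: linear_diff)
qed

text \<open>\<open>theta\<close> is \<open>Theta\<close> and \<open>beta\<close> the tangent bracket, both read in the chart \<open>c\<close> at \<open>e\<close>.\<close>

locale pointed_Lie_rack_chart =
  fixes Q :: "('a, 'e::real_normed_vector) manifold" and r :: "'a \<Rightarrow> 'a \<Rightarrow> 'a" and e :: 'a
    and c :: "('a, 'e) chart"
  assumes pLr: "pointed_Lie_rack Q r e" and c: "c \<in> charts_at Q e"
begin

lemma Q: "smooth_manifold Q" and e: "e \<in> points Q"
  and smooth_r: "smooth_map (prod_manifold Q Q) Q (\<lambda>(x, y). r x y)"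
  and r_e: "p \<in> points Q \<Longrightarrow> r p e = e" and e_r: "p \<in> points Q \<Longrightarrow> r e p = p"
  and r_in: "p \<in> points Q \<Longrightarrow> q \<in> points Q \<Longrightarrow> r p q \<in> points Q"
  and r_distrib: "p \<in> points Q \<Longrightarrow> q \<in> points Q \<Longrightarrow> x \<in> points Q \<Longrightarrow>
    r p (r q x) = r (r p q) (r p x)"
  using pLr unfolding pointed_Lie_rack_def rack_def by blast+

lemmas c_atlas = charts_atD(1)[OF c] and e_c = charts_atD(2)[OF c]

lemmas c_subset = chart_subset[OF Q c_atlas] and c_inv_c = chart_inv_chart[OF Q c_atlas]
  and c_open = chart_homeomorphic(2)[OF Q c_atlas]

lemma e_c_image: "snd c e \<in> snd c ` fst c"
  using e_c by blast

lemma c_inv_points: "x \<in> snd c ` fst c \<Longrightarrow> chart_inv c x \<in> points Q"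
  by (rule subsetD[OF c_subset chart_inv_in])

abbreviation T :: "('a, 'e) tangent_vector set" where
  "T \<equiv> tangent_space Q e"

section \<open>Derivatives at the base point in the chart \<open>c\<close>\<close>

definition deriv_at_e :: "('a \<Rightarrow> 'a) \<Rightarrow> 'e \<Rightarrow> 'e" where
  "deriv_at_e f = frechet_derivative (snd c \<circ> f \<circ> chart_inv c) (at (snd c e))"

text \<open>A common class for \<open>A\<close> and the maps \<open>r p\<close>: since all of them
  fix \<open>e\<close>, their derivatives are endomorphisms of the model space and compose within
  the one chart \<open>c\<close>.\<close>

definition diff_fixing_e :: "('a \<Rightarrow> 'a) \<Rightarrow> bool" where
  "diff_fixing_e f \<longleftrightarrow> continuous_map (mtop Q) (mtop Q) f \<and> f e = e \<and> chart_differentiable Q Q f e"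

lemma diff_fixing_e_has_derivative:
  assumes "diff_fixing_e f"
  shows "(snd c \<circ> f \<circ> chart_inv c has_derivative deriv_at_e f) (at (snd c e))"
  using assms c unfolding diff_fixing_e_def deriv_at_e_def by (auto intro: chart_differentiableD)

lemma diff_fixing_e_points: "diff_fixing_e f \<Longrightarrow> p \<in> points Q \<Longrightarrow> f p \<in> points Q"
  by (auto simp: diff_fixing_e_def continuous_map_def)

lemma diff_fixing_e_chart_compose:
  fixes h :: "'a \<Rightarrow> 'g::real_normed_vector"
  assumes f: "diff_fixing_e f" and G: "(h \<circ> chart_inv c has_derivative G) (at (snd c e))"
  shows "(h \<circ> f \<circ> chart_inv c has_derivative G \<circ> deriv_at_e f) (at (snd c e))"
  using f c G by (intro has_derivative_chart_compose[OF Q Q _ c _ diff_fixing_e_has_derivative[OF f]])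
    (auto simp: diff_fixing_e_def)

text \<open>The device behind the bracket identities: an identity between two functions on
  \<open>Q\<close> passes to their derivatives at \<open>e\<close>.\<close>

lemma chart_derivative_unique:
  fixes h k :: "'a \<Rightarrow> 'g::real_normed_vector"
  assumes "(h \<circ> chart_inv c has_derivative G) (at (snd c e))"
    "(k \<circ> chart_inv c has_derivative H) (at (snd c e))"
    "\<And>p. p \<in> points Q \<Longrightarrow> h p = k p"
  shows "G = H"
proof -
  have "(k \<circ> chart_inv c has_derivative G) (at (snd c e))"
    using assms(3) c_inv_points
    by (intro has_derivative_transform_within_open[OF assms(1) c_open e_c_image]) simp
  then show ?thesis using assms(2) by (rule has_derivative_unique)
qed

lemma deriv_at_e_compose_commute:
  assumes "diff_fixing_e f" "diff_fixing_e g" "diff_fixing_e f'" "diff_fixing_e g'"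
    "\<And>p. p \<in> points Q \<Longrightarrow> g (f p) = g' (f' p)"
  shows "deriv_at_e g (deriv_at_e f v) = deriv_at_e g' (deriv_at_e f' v)"
proof -
  have "deriv_at_e g \<circ> deriv_at_e f = deriv_at_e g' \<circ> deriv_at_e f'"
    using diff_fixing_e_chart_compose[OF assms(1) diff_fixing_e_has_derivative[OF assms(2)]]
      diff_fixing_e_chart_compose[OF assms(3) diff_fixing_e_has_derivative[OF assms(4)]]
    by (rule chart_derivative_unique) (simp add: assms(5))
  then show ?thesis by (simp add: fun_eq_iff)
qed

text \<open>In coordinates \<open>r p\<close> is the map \<open>?R\<close> restricted to the slice
  with first coordinate \<open>snd b p\<close>, so its derivative is a partial derivative of
  \<open>?R\<close>. The formula is explicit because \<open>theta_has_derivative\<close>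
  differentiates it again in \<open>p\<close>.\<close>

lemma chart_r_differentiable:
  assumes "p \<in> points Q" "b \<in> charts_at Q p" "d \<in> charts_at Q e" "d' \<in> charts_at Q e"
  shows "(snd d' \<circ> r p \<circ> chart_inv d has_derivative
    (\<lambda>v. frechet_derivative (snd d' \<circ> (\<lambda>(x, y). r x y) \<circ> chart_inv (prod_chart b d)) (at (snd b p, snd d e)) (0, v)))
    (at (snd d e))" (is "(_ has_derivative (\<lambda>v. frechet_derivative ?R _ _)) _")
proof (rule has_derivative_transform_within_open)
  note b = charts_atD[OF assms(2)] and d = charts_atD[OF assms(3)] and d' = charts_atD[OF assms(4)]
  have "prod_chart b d \<in> atlas (prod_manifold Q Q)"
    using b d unfolding atlas_prod_manifold by blast
  moreover have "(snd b p, snd d e) \<in> snd (prod_chart b d) `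
      (fst (prod_chart b d) \<inter> (\<lambda>(x, y). r x y) -` fst d')"
    using b d d' r_e[OF assms(1)] by (auto intro!: image_eqI[of _ _ "(p, e)"])
  ultimately have "?R differentiable (at (snd b p, snd d e))"
    using smooth_onD[OF smooth_mapD(2)[OF smooth_r _ d'(1)]] by blast
  then have "(?R has_derivative frechet_derivative ?R (at (snd b p, snd d e))) (at (snd b p, snd d e))"
    by (simp add: frechet_derivative_works)
  moreover have "((\<lambda>y. (snd b p, y)) has_derivative (\<lambda>v. (0, v))) (at (snd d e))"
    by (auto intro!: derivative_eq_intros)
  ultimately show "(?R \<circ> (\<lambda>y. (snd b p, y)) has_derivative
      (\<lambda>v. frechet_derivative ?R (at (snd b p, snd d e)) (0, v))) (at (snd d e))"
    using diff_chain_at[of "\<lambda>y. (snd b p, y)" "\<lambda>v. (0, v)" "snd d e" ?R] by (simp add: o_def)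
  show "open (snd d ` fst d)" by (rule chart_homeomorphic(2)[OF Q d(1)])
  show "snd d e \<in> snd d ` fst d" using d by blast
  show "(?R \<circ> (\<lambda>y. (snd b p, y))) y = (snd d' \<circ> r p \<circ> chart_inv d) y" if "y \<in> snd d ` fst d" for y
    using chart_inv_prod_chart[OF Q Q b(1) d(1) _ that, of "snd b p"] b chart_inv_chart[OF Q b(1)]
    by simp
qed

lemma diff_fixing_e_r: "p \<in> points Q \<Longrightarrow> diff_fixing_e (r p)"
  unfolding diff_fixing_e_def
proof (intro conjI)
  assume p: "p \<in> points Q"
  have "continuous_map (mtop Q) (prod_topology (mtop Q) (mtop Q)) (\<lambda>y. (p, y))"
    using p by (intro continuous_map_pairedI) (auto simp: continuous_map_id[unfolded id_def])
  from continuous_map_compose[OF this, of "mtop Q" "\<lambda>(x, y). r x y"]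
  show "continuous_map (mtop Q) (mtop Q) (r p)"
    using smooth_mapD(1)[OF smooth_r] by (simp add: o_def)
  show "r p e = e" by (rule r_e[OF p])
  obtain b where "b \<in> charts_at Q p" by (rule ex_chart[OF Q p])
  from chart_r_differentiable[OF p this] show "chart_differentiable Q Q (r p) e"
    unfolding chart_differentiable_def \<open>r p e = e\<close> differentiable_def by blast
qed

section \<open>The bracket in coordinates and its identities\<close>

definition theta :: "'a \<Rightarrow> 'e \<Rightarrow> 'e" where
  "theta p = deriv_at_e (r p)"

definition beta :: "'e \<Rightarrow> 'e \<Rightarrow> 'e" where
  "beta u v = frechet_derivative ((\<lambda>p. theta p v) \<circ> chart_inv c) (at (snd c e)) u"

lemma bounded_linear_deriv_at_e: "diff_fixing_e f \<Longrightarrow> bounded_linear (deriv_at_e f)"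
  using diff_fixing_e_has_derivative has_derivative_bounded_linear by blast

lemma bounded_linear_theta: "p \<in> points Q \<Longrightarrow> bounded_linear (theta p)"
  unfolding theta_def by (intro bounded_linear_deriv_at_e diff_fixing_e_r)

lemma theta_e: "theta e v = v"
proof -
  have "theta e = frechet_derivative (snd c \<circ> chart_inv c) (at (snd c e))"
    unfolding theta_def deriv_at_e_def using c_inv_points
    by (intro frechet_derivative_cong_open[OF c_open e_c_image]) (simp add: e_r)
  then show ?thesis using frechet_derivative_self_chart[OF Q c] by simp
qed

text \<open>In coordinates \<open>theta p v\<close> is the partial derivative of \<open>R\<close> in
  the direction \<open>(0, v)\<close>, evaluated along the slice with second coordinate
  \<open>snd c e\<close>.\<close>

lemma theta_has_derivative: "((\<lambda>p. theta p v) \<circ> chart_inv c has_derivative (\<lambda>u. beta u v)) (at (snd c e))"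
proof -
  define R where "R = snd c \<circ> (\<lambda>(x, y). r x y) \<circ> chart_inv (prod_chart c c)"
  define S where "S = snd (prod_chart c c) ` (fst (prod_chart c c) \<inter> (\<lambda>(x, y). r x y) -` fst c)"
  have "prod_chart c c \<in> atlas (prod_manifold Q Q)"
    using c_atlas unfolding atlas_prod_manifold by blast
  \<comment> \<open>One order of differentiability is spent on the partial derivative, the other on
    differentiating it.\<close>
  from smooth_mapD(2)[OF smooth_r this c_atlas] have "Ck_on (Suc (Suc 0)) S R"
    by (simp add: smooth_on_def S_def R_def)
  then have R: "(\<lambda>z. frechet_derivative R (at z) (0, v)) differentiable (at z)" if "z \<in> S" for z
    using that by simp
  have "(snd c e, snd c e) \<in> S"
    unfolding S_def using e_c r_e[OF e] by (auto intro!: image_eqI[of _ _ "(e, e)"])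
  from R[OF this] obtain D where "((\<lambda>z. frechet_derivative R (at z) (0, v)) has_derivative D) (at (snd c e, snd c e))"
    unfolding differentiable_def by blast
  moreover have "((\<lambda>x. (x, snd c e)) has_derivative (\<lambda>u. (u, 0))) (at (snd c e))"
    by (auto intro!: derivative_eq_intros)
  ultimately have "((\<lambda>x. frechet_derivative R (at (x, snd c e)) (0, v)) has_derivative (\<lambda>u. D (u, 0))) (at (snd c e))"
    using diff_chain_at[of "\<lambda>x. (x, snd c e)" "\<lambda>u. (u, 0)" "snd c e" "\<lambda>z. frechet_derivative R (at z) (0, v)" D]
    by (simp add: o_def)
  then have "((\<lambda>p. theta p v) \<circ> chart_inv c has_derivative (\<lambda>u. D (u, 0))) (at (snd c e))"
  proof (rule has_derivative_transform_within_open[OF _ c_open e_c_image])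
    fix x assume x: "x \<in> snd c ` fst c"
    have "chart_inv c x \<in> points Q" "c \<in> charts_at Q (chart_inv c x)"
      using c_inv_points[OF x] chart_inv_in[OF x] c_atlas by (simp_all add: charts_at_def)
    from chart_r_differentiable[OF this c c] chart_chart_inv[OF x]
    have "(snd c \<circ> r (chart_inv c x) \<circ> chart_inv c has_derivative
        (\<lambda>v. frechet_derivative R (at (x, snd c e)) (0, v))) (at (snd c e))"
      by (simp add: R_def)
    from frechet_derivative_at[OF this]
    show "frechet_derivative R (at (x, snd c e)) (0, v) = ((\<lambda>p. theta p v) \<circ> chart_inv c) x"
      by (simp add: theta_def deriv_at_e_def fun_eq_iff)
  qed
  then show ?thesis
    unfolding beta_def using differentiableI frechet_derivative_works by blast
qed

lemma theta_compose_has_derivative: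
  assumes "diff_fixing_e f"
  shows "((\<lambda>p. theta (f p) v) \<circ> chart_inv c has_derivative (\<lambda>u. beta (deriv_at_e f u) v)) (at (snd c e))"
  using diff_fixing_e_chart_compose[OF assms theta_has_derivative] by (simp add: o_def)

text \<open>Linearity in the second argument is inherited from each \<open>theta p\<close> by
  uniqueness of derivatives; in the first argument it is that of a derivative.\<close>

lemma linear_beta_right: "linear (beta u)"
proof (rule linearI)
  fix v w
  have "((\<lambda>p. theta p v + theta p w) \<circ> chart_inv c has_derivative (\<lambda>u. beta u v + beta u w)) (at (snd c e))"
    using has_derivative_add[OF theta_has_derivative theta_has_derivative] by (simp add: o_def)
  from chart_derivative_unique[OF theta_has_derivative[of "v + w"] this]
  have "(\<lambda>u. beta u (v + w)) = (\<lambda>u. beta u v + beta u w)"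
    by (simp add: linear_add[OF bounded_linear.linear[OF bounded_linear_theta]])
  then show "beta u (v + w) = beta u v + beta u w" by meson
next
  fix s v
  have "((\<lambda>p. s *\<^sub>R theta p v) \<circ> chart_inv c has_derivative (\<lambda>u. s *\<^sub>R beta u v)) (at (snd c e))"
    using has_derivative_scaleR_right[OF theta_has_derivative] by (simp add: o_def)
  from chart_derivative_unique[OF theta_has_derivative[of "s *\<^sub>R v"] this]
  have "(\<lambda>u. beta u (s *\<^sub>R v)) = (\<lambda>u. s *\<^sub>R beta u v)"
    by (simp add: linear_scale[OF bounded_linear.linear[OF bounded_linear_theta]])
  then show "beta u (s *\<^sub>R v) = s *\<^sub>R beta u v" by meson
qed

text \<open>Prepares the product rule in \<open>beta_leibniz\<close>.\<close>

lemma bounded_bilinear_beta: "bounded_bilinear beta"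
  using has_derivative_bounded_linear[OF theta_has_derivative] linear_beta_right
  by (intro fin_dim_bounded_bilinear fin_dim_manifold[OF Q])

text \<open>Differentiate \<open>theta p (theta q w) = theta (r p q) (theta p w)\<close> with respect to \<open>q\<close> at \<open>e\<close>.\<close>

lemma theta_beta:
  assumes p: "p \<in> points Q"
  shows "theta p (beta v w) = beta (theta p v) (theta p w)"
proof -
  have "((\<lambda>q. theta p (theta q w)) \<circ> chart_inv c has_derivative (\<lambda>v. theta p (beta v w))) (at (snd c e))"
    using bounded_linear.has_derivative[OF bounded_linear_theta[OF p] theta_has_derivative[of w]] by (simp add: o_def)
  moreover have "((\<lambda>q. theta (r p q) (theta p w)) \<circ> chart_inv c has_derivative
      (\<lambda>v. beta (deriv_at_e (r p) v) (theta p w))) (at (snd c e))"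
    by (rule theta_compose_has_derivative[OF diff_fixing_e_r[OF p]])
  moreover have "theta p (theta q w) = theta (r p q) (theta p w)" if "q \<in> points Q" for q
    unfolding theta_def using p that by (intro deriv_at_e_compose_commute diff_fixing_e_r r_in r_distrib)
  ultimately have "(\<lambda>v. theta p (beta v w)) = (\<lambda>v. beta (deriv_at_e (r p) v) (theta p w))"
    by (rule chart_derivative_unique)
  then show ?thesis unfolding theta_def by meson
qed

text \<open>Differentiate \<open>theta_beta\<close> with respect to \<open>p\<close> at \<open>e\<close>.\<close>

lemma beta_leibniz: "beta u (beta v w) = beta (beta u v) w + beta v (beta u w)"
proof -
  have "chart_inv c (snd c e) = e" using c_inv_c e_c by blast
  \<comment> \<open>The product rule at \<open>e\<close>, where \<open>theta e\<close> is the
    identity, so the undifferentiated factors are \<open>v\<close> and \<open>w\<close>.\<close>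
  then have "((\<lambda>p. beta (theta p v) (theta p w)) \<circ> chart_inv c has_derivative
      (\<lambda>u. beta v (beta u w) + beta (beta u v) w)) (at (snd c e))"
    using bounded_bilinear.FDERIV[OF bounded_bilinear_beta theta_has_derivative[of v] theta_has_derivative[of w]]
    by (simp add: o_def theta_e)
  from chart_derivative_unique[OF theta_has_derivative this theta_beta]
  have "(\<lambda>u. beta u (beta v w)) = (\<lambda>u. beta v (beta u w) + beta (beta u v) w)" .
  then show ?thesis by (metis add.commute)
qed

lemma beta_averaging:
  assumes A: "diff_fixing_e A" "\<And>p q. p \<in> points Q \<Longrightarrow> q \<in> points Q \<Longrightarrow> r (A p) (A q) = A (r (A p) q)"
  shows "beta (deriv_at_e A u) (deriv_at_e A v) = deriv_at_e A (beta (deriv_at_e A u) v)"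
proof -
  have "((\<lambda>p. deriv_at_e A (theta (A p) v)) \<circ> chart_inv c has_derivative
      (\<lambda>u. deriv_at_e A (beta (deriv_at_e A u) v))) (at (snd c e))"
    using bounded_linear.has_derivative[OF bounded_linear_deriv_at_e[OF A(1)]
        theta_compose_has_derivative[OF A(1), of v]] by (simp add: o_def)
  note theta_compose_has_derivative[OF A(1), of "deriv_at_e A v"] this
  \<comment> \<open>For fixed \<open>p\<close> the averaging identity says that
    \<open>r (A p)\<close> and \<open>A\<close> commute on the image of the relevant points:
    \<open>r (A p) (A q)\<close> equals \<open>A (r (A p) q)\<close> for all \<open>q\<close>. It is
    differentiated in \<open>q\<close> at \<open>e\<close>.\<close>
  moreover have "theta (A p) (deriv_at_e A v) = deriv_at_e A (theta (A p) v)" if p: "p \<in> points Q" for p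
  proof -
    have diff_fixing_e: "diff_fixing_e (r (A p))" by (rule diff_fixing_e_r[OF diff_fixing_e_points[OF A(1) p]])
    show ?thesis
      unfolding theta_def by (rule deriv_at_e_compose_commute[OF A(1) diff_fixing_e diff_fixing_e A(1)]) (rule A(2)[OF p])
  qed
  ultimately have "(\<lambda>u. beta (deriv_at_e A u) (deriv_at_e A v)) = (\<lambda>u. deriv_at_e A (beta (deriv_at_e A u) v))"
    by (rule chart_derivative_unique)
  then show ?thesis by meson
qed

section \<open>From coordinates back to endomorphisms of the tangent space\<close>

definition lift :: "('e \<Rightarrow> 'e) \<Rightarrow> ('a, 'e) tangent_vector \<Rightarrow> ('a, 'e) tangent_vector" where
  "lift L = (\<lambda>Y. if Y \<in> T then tvec Q e c (L (Y c)) else 0)"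

text \<open>\<open>lift\<close> conjugates by the linear isomorphism \<open>tvec\<close> onto
  \<open>T\<close>; its value 0 off \<open>T\<close> is the normalisation demanded by
  \<open>gl\<close>.\<close>

lemma lift_in_gl:
  assumes "linear L"
  shows "lift L \<in> gl T"
proof -
  have "lift L Y \<in> T" if "Y \<in> T" for Y
    using that tvec_in_tangent_space[OF Q c] by (simp add: lift_def)
  moreover have "lift L (X + Y) = lift L X + lift L Y" if "X \<in> T" "Y \<in> T" for X Y
    using that subspace_add[OF subspace_tangent_space[OF Q c]]
    by (simp add: lift_def linear_add[OF assms] linear_add[OF linear_tvec[OF Q c]])
  moreover have "lift L (s *\<^sub>R X) = s *\<^sub>R lift L X" if "X \<in> T" for s X
    using that subspace_scale[OF subspace_tangent_space[OF Q c]]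
    by (simp add: lift_def linear_scale[OF assms] linear_scale[OF linear_tvec[OF Q c]])
  ultimately show ?thesis
    by (simp add: gl_def linear_map_on_def) (simp add: lift_def)
qed

lemma Theta_eq_lift:
  assumes "p \<in> points Q"
  shows "Theta Q r e p = lift (theta p)"
proof -
  have "differential Q Q (r p) e Y = tvec Q e c (theta p (Y c))" if "Y \<in> T" for Y
    using differential_eq_tvec[OF Q Q c, of "r p" c Y] diff_fixing_e_r[OF assms] that c
    by (simp add: diff_fixing_e_def theta_def deriv_at_e_def)
  then show ?thesis by (auto simp: Theta_def lift_def fun_eq_iff)
qed

text \<open>The expansion of a matrix in elementary matrices: the coefficients
  \<open>k b' (L b)\<close> are the entries of \<open>L\<close>, and the lifted maps do not depend
  on \<open>L\<close>.\<close>

lemma lift_expand: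
  assumes "linear L" "finite Bs" "\<And>v. v = (\<Sum>b\<in>Bs. k b v *\<^sub>R b)"
  shows "lift L = (\<Sum>b\<in>Bs. \<Sum>b'\<in>Bs. k b' (L b) *\<^sub>R lift (\<lambda>v. k b v *\<^sub>R b'))"
proof
  fix Y
  have L: "L v = (\<Sum>b\<in>Bs. \<Sum>b'\<in>Bs. k b' (L b) *\<^sub>R (k b v *\<^sub>R b'))" for v
  proof -
    have "L v = (\<Sum>b\<in>Bs. k b v *\<^sub>R L b)"
      using linear_expand[OF assms(1) assms(3)] .
    also have "\<dots> = (\<Sum>b\<in>Bs. k b v *\<^sub>R (\<Sum>b'\<in>Bs. k b' (L b) *\<^sub>R b'))"
      by (simp only: assms(3)[symmetric])
    finally show ?thesis by (simp add: scaleR_sum_right mult.commute)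
  qed
  have "tvec Q e c (L v) = (\<Sum>b\<in>Bs. \<Sum>b'\<in>Bs. k b' (L b) *\<^sub>R tvec Q e c (k b v *\<^sub>R b'))" for v
    by (subst L) (simp add: linear_sum[OF linear_tvec[OF Q c]] linear_scale[OF linear_tvec[OF Q c]])
  then show "lift L Y = (\<Sum>b\<in>Bs. \<Sum>b'\<in>Bs. k b' (L b) *\<^sub>R lift (\<lambda>v. k b v *\<^sub>R b')) Y"
    by (simp add: lift_def)
qed

text \<open>The functional \<open>l\<close> is merely linear, with no continuity, so it cannot be
  moved through a derivative directly. By \<open>lift_expand\<close> the composite is a finite
  combination of matrix entries of \<open>theta\<close>, each of them differentiable.\<close>

lemma Theta_has_derivative:
  assumes l: "linear (l :: _ \<Rightarrow> real)" and d: "d \<in> charts_at Q e"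
  shows "((l \<circ> Theta Q r e \<circ> chart_inv d) has_derivative
    (\<lambda>u. l (lift (beta (frechet_derivative (snd c \<circ> chart_inv d) (at (snd d e)) u))))) (at (snd d e))"
proof -
  define D where "D = frechet_derivative (snd c \<circ> chart_inv d) (at (snd d e))"
  obtain Bs :: "'e set" and k where Bs: "finite Bs" "\<And>b. bounded_linear (k b)"
    "\<And>v. v = (\<Sum>b\<in>Bs. k b v *\<^sub>R b)"
    by (rule fin_dim_coordinates[OF fin_dim_manifold[OF Q]]) blast
  have l_lift: "l (lift L) = (\<Sum>b\<in>Bs. \<Sum>b'\<in>Bs. k b' (L b) *\<^sub>R l (lift (\<lambda>v. k b v *\<^sub>R b')))"
    if "linear L" for L
    by (subst lift_expand[OF that Bs(1,3)]) (simp add: linear_sum[OF l] linear_scale[OF l])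
  \<comment> \<open>The derivative of \<open>theta\<close> is known in the chart \<open>c\<close>;
    the factor \<open>D\<close> carries it to the chart \<open>d\<close>.\<close>
  have theta: "((\<lambda>x. theta (chart_inv d x) b) has_derivative (\<lambda>u. beta (D u) b)) (at (snd d e))" for b
  proof -
    have "((\<lambda>p. theta p b) \<circ> id \<circ> chart_inv d has_derivative (\<lambda>u. beta u b) \<circ> D) (at (snd d e))"
      using c d transition_has_derivative[OF Q d c] theta_has_derivative[of b]
      by (intro has_derivative_chart_compose[where d=c and M=Q and N=Q]) (auto simp: Q D_def)
    then show ?thesis by (simp add: o_def)
  qed
  have "((\<lambda>x. \<Sum>b\<in>Bs. \<Sum>b'\<in>Bs. k b' (theta (chart_inv d x) b) *\<^sub>R l (lift (\<lambda>v. k b v *\<^sub>R b'))) has_derivative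
      (\<lambda>u. \<Sum>b\<in>Bs. \<Sum>b'\<in>Bs. k b' (beta (D u) b) *\<^sub>R l (lift (\<lambda>v. k b v *\<^sub>R b')))) (at (snd d e))"
    by (intro has_derivative_sum has_derivative_scaleR_left bounded_linear.has_derivative[OF Bs(2)] theta)
  then have "((l \<circ> Theta Q r e \<circ> chart_inv d) has_derivative
      (\<lambda>u. \<Sum>b\<in>Bs. \<Sum>b'\<in>Bs. k b' (beta (D u) b) *\<^sub>R l (lift (\<lambda>v. k b v *\<^sub>R b')))) (at (snd d e))"
  proof (rule has_derivative_transform_within_open)
    note d = charts_atD[OF d]
    show "open (snd d ` fst d)" by (rule chart_homeomorphic(2)[OF Q d(1)])
    show "snd d e \<in> snd d ` fst d" using d by blast
    fix x assume "x \<in> snd d ` fst d"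
    then have p: "chart_inv d x \<in> points Q"
      by (intro subsetD[OF chart_subset[OF Q d(1)] chart_inv_in])
    show "(\<Sum>b\<in>Bs. \<Sum>b'\<in>Bs. k b' (theta (chart_inv d x) b) *\<^sub>R l (lift (\<lambda>v. k b v *\<^sub>R b')))
        = (l \<circ> Theta Q r e \<circ> chart_inv d) x"
      by (simp only: o_apply Theta_eq_lift[OF p] l_lift[OF bounded_linear.linear[OF bounded_linear_theta[OF p]]])
  qed
  then show ?thesis
    by (simp only: l_lift[OF linear_beta_right] D_def)
qed

lemma tangent_space_transition:
  assumes "X \<in> T" "d \<in> charts_at Q e"
  shows "frechet_derivative (snd c \<circ> chart_inv d) (at (snd d e)) (X d) = X c"
  by (rule sym) (use assms c in \<open>unfold tangent_space_def, blast\<close>)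

text \<open>\<open>Theta_has_derivative\<close> in every chart shows that the lifted map qualifies.
  Any other candidate has the same value under each functional, as the chart \<open>c\<close> alone
  shows, and functionals separate points.\<close>

lemma ad_eq_lift:
  assumes X: "X \<in> T"
  shows "ad Q r e X = lift (beta (X c))"
  unfolding ad_def vector_differential_def
proof (rule the_equality)
  show "lift (beta (X c)) \<in> gl T \<and> (\<forall>l::_ \<Rightarrow> real. linear l \<longrightarrow> (\<forall>d\<in>charts_at Q e. \<exists>D.
      ((l \<circ> Theta Q r e \<circ> chart_inv d) has_derivative D) (at (snd d e)) \<and> l (lift (beta (X c))) = D (X d)))"
  proof (intro conjI allI impI ballI)
    show "lift (beta (X c)) \<in> gl T" by (rule lift_in_gl[OF linear_beta_right])
    fix l :: "(('a, 'e) tangent_vector \<Rightarrow> ('a, 'e) tangent_vector) \<Rightarrow> real" and d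
    assume "linear l" and d: "d \<in> charts_at Q e"
    then show "\<exists>D. ((l \<circ> Theta Q r e \<circ> chart_inv d) has_derivative D) (at (snd d e)) \<and> l (lift (beta (X c))) = D (X d)"
      by (intro exI conjI, rule Theta_has_derivative) (simp_all only: tangent_space_transition[OF X d])
  qed
next
  fix w assume w: "w \<in> gl T \<and> (\<forall>l::_ \<Rightarrow> real. linear l \<longrightarrow> (\<forall>d\<in>charts_at Q e. \<exists>D.
      ((l \<circ> Theta Q r e \<circ> chart_inv d) has_derivative D) (at (snd d e)) \<and> l w = D (X d)))"
  show "w = lift (beta (X c))"
  proof (rule linear_functional_eqI)
    fix l :: "(('a, 'e) tangent_vector \<Rightarrow> ('a, 'e) tangent_vector) \<Rightarrow> real" assume l: "linear l"
    then obtain D where D: "((l \<circ> Theta Q r e \<circ> chart_inv c) has_derivative D) (at (snd c e))" "l w = D (X c)"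
      using w c by blast
    show "l w = l (lift (beta (X c)))"
      unfolding D(2) has_derivative_unique[OF D(1) Theta_has_derivative[OF l c]]
      by (simp only: tangent_space_transition[OF X c])
  qed
qed

lemma tangent_bracket_eq_tvec:
  assumes "X \<in> T" "Y \<in> T"
  shows "tangent_bracket Q r e X Y = tvec Q e c (beta (X c) (Y c))"
  using assms by (simp add: tangent_bracket_def ad_eq_lift lift_def)

lemma leibniz_algebra_tangent_bracket: "leibniz_algebra T (tangent_bracket Q r e)"
proof -
  note sub = subspace_tangent_space[OF Q c]
  note [simp] = tangent_bracket_eq_tvec tvec_chart[OF Q c] tvec_in_tangent_space[OF Q c]
    subspace_add[OF sub] subspace_scale[OF sub]
  note simps = linear_add[OF linear_tvec[OF Q c], symmetric] linear_scale[OF linear_tvec[OF Q c], symmetric]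
    bounded_bilinear.add_left[OF bounded_bilinear_beta] bounded_bilinear.add_right[OF bounded_bilinear_beta]
    bounded_bilinear.scaleR_left[OF bounded_bilinear_beta] bounded_bilinear.scaleR_right[OF bounded_bilinear_beta]
  have "tangent_bracket Q r e X (tangent_bracket Q r e Y Z)
      = tangent_bracket Q r e (tangent_bracket Q r e X Y) Z + tangent_bracket Q r e Y (tangent_bracket Q r e X Z)"
    if "X \<in> T" "Y \<in> T" "Z \<in> T" for X Y Z
    using that beta_leibniz[of "X c" "Y c" "Z c"] by (simp add: simps)
  moreover have "linear_map_on T T (tangent_bracket Q r e X)"
    "linear_map_on T T (\<lambda>Y. tangent_bracket Q r e Y X)" if "X \<in> T" for X
    using that by (simp_all add: linear_map_on_def simps)
  ultimately show ?thesis
    unfolding leibniz_algebra_def using sub by blast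
qed

lemma differential_eq_deriv_at_e:
  "diff_fixing_e f \<Longrightarrow> X \<in> T \<Longrightarrow> differential Q Q f e X = tvec Q e c (deriv_at_e f (X c))"
  using differential_eq_tvec[OF Q Q c, of f c X] c by (simp add: diff_fixing_e_def deriv_at_e_def)

end

section \<open>Averaging operators and the descendent bracket\<close>

theorem theorem7p11:
  fixes Q :: "('a, 'e::real_normed_vector) manifold"
    and r :: "'a \<Rightarrow> 'a \<Rightarrow> 'a" and e :: 'a and A :: "'a \<Rightarrow> 'a"
  assumes "pointed_Lie_rack Q r e"
    and "smooth_pointed_averaging_operator Q r e A"
  shows "left_averaging_operator (tangent_space Q e) (tangent_bracket Q r e) (differential Q Q A e)
    \<and> (pointed_Lie_rack Q (descendent r A) e \<and>
       leibniz_algebra (tangent_space Q e) (tangent_bracket Q (descendent r A) e) \<and>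
       (\<forall>X\<in>tangent_space Q e. \<forall>Y\<in>tangent_space Q e.
          tangent_bracket Q (descendent r A) e X Y
            = tangent_bracket Q r e (differential Q Q A e X) Y))"
proof -
  have "smooth_manifold Q" "e \<in> points Q"
    using assms(1) by (simp_all add: pointed_Lie_rack_def)
  then obtain c where c: "c \<in> charts_at Q e" by (rule ex_chart)
  interpret R: pointed_Lie_rack_chart Q r e c
    using assms(1) c by unfold_locales
  have desc: "pointed_Lie_rack Q (descendent r A) e"
    using assms by (rule pointed_Lie_rack_descendent)
  \<comment> \<open>The descendent rack is read in the same chart, so the two coordinate brackets
    can be compared directly. Its Leibniz identity comes from this instance.\<close>
  interpret D: pointed_Lie_rack_chart Q "descendent r A" e c
    using desc c by unfold_locales
  have A: "R.diff_fixing_e A" "\<And>p q. p \<in> points Q \<Longrightarrow> q \<in> points Q \<Longrightarrow> r (A p) (A q) = A (r (A p) q)"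
    using assms(2) smooth_mapD(1)[of Q Q A] smooth_map_chart_differentiable[of Q Q A]
    by (auto simp: smooth_pointed_averaging_operator_def R.diff_fixing_e_def)
  define P where "P = R.deriv_at_e A"
  have P: "linear P"
    unfolding P_def using R.bounded_linear_deriv_at_e[OF A(1)] by (rule bounded_linear.linear)
  have dA: "differential Q Q A e X = tvec Q e c (P (X c))" if "X \<in> R.T" for X
    unfolding P_def using A(1) that by (rule R.differential_eq_deriv_at_e)
  note sub = subspace_tangent_space[OF R.Q c] and lin = linear_tvec[OF R.Q c]
  note [simp] = tvec_chart[OF R.Q c] tvec_in_tangent_space[OF R.Q c]
    subspace_add[OF sub] subspace_scale[OF sub]
  have "linear_map_on R.T R.T (differential Q Q A e)"
    by (auto simp: linear_map_on_def dA linear_add[OF P] linear_add[OF lin] linear_scale[OF P] linear_scale[OF lin])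
  moreover have "tangent_bracket Q r e (differential Q Q A e X) (differential Q Q A e Y)
      = differential Q Q A e (tangent_bracket Q r e (differential Q Q A e X) Y)"
    if "X \<in> R.T" "Y \<in> R.T" for X Y
    using that R.beta_averaging[OF A, of "X c" "Y c"] by (simp add: R.tangent_bracket_eq_tvec dA P_def)
  ultimately have "left_averaging_operator R.T (tangent_bracket Q r e) (differential Q Q A e)"
    using R.leibniz_algebra_tangent_bracket by (simp add: left_averaging_operator_def)
  moreover have "tangent_bracket Q (descendent r A) e X Y
      = tangent_bracket Q r e (differential Q Q A e X) Y" if "X \<in> R.T" "Y \<in> R.T" for X Y
  proof -
    have "D.theta p = R.theta (A p)" for p
    proof -
      have "descendent r A p = r (A p)" by (simp add: descendent_def fun_eq_iff)
      then show ?thesis by (simp add: D.theta_def R.theta_def)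
    qed
    \<comment> \<open>Both sides are derivatives at \<open>e\<close> of the same function
      \<open>\<lambda>p. R.theta (A p) (Y c)\<close>; on the right the chain rule produces
      \<open>P\<close>.\<close>
    then have "(\<lambda>u. D.beta u (Y c)) = (\<lambda>u. R.beta (P u) (Y c))"
      using D.theta_has_derivative[of "Y c"] R.theta_compose_has_derivative[OF A(1), of "Y c"]
      unfolding P_def by (simp add: has_derivative_unique)
    then have "D.beta (X c) (Y c) = R.beta (P (X c)) (Y c)" by meson
    with that show ?thesis
      by (simp add: D.tangent_bracket_eq_tvec R.tangent_bracket_eq_tvec dA)
  qed
  ultimately show ?thesis
    using desc D.leibniz_algebra_tangent_bracket by blast
qed

end
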